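(* Let $A$ be an abelian group generated by two elements $a,b$, and let $\varphi,\psi:A\to S_n$ be homomorphisms that are generator-conjugate with respect to $a,b$ and satisfy $\varphi(a)=\psi(a)=\sigma$. With the decompositions $\varphi(b)=\mu_0\pi_1\cdots\pi_l$, $\psi(b)=\mu_0'\pi_1'\cdots\pi_l'$, $\pi_i=\mu_i\pi_{0,i}$, $\pi_i'=\mu_i'\pi_{0,i}'$, $\mu_i=\tau_{1,i}^{z_{(1,i)}}\cdots\tau_{k_i,i}^{z_{(k_i,i)}}$, $\mu_i'=\tau_{1,i}^{z_{(1,i)}'}\cdots\tau_{k_i,i}^{z_{(k_i,i)}'}$, $\pi_{0,i}=x_{(1,i)}\cdots x_{(h,i)}$, $\pi_{0,i}'=y_{(1,i)}\cdots y_{(h',i)}$ described in the context, the homomorphisms $\varphi,\psi$ are conjugate if and only if all of the following hold: (i) $\mu_0$ and $\mu_0'$ are conjugate in $S_n$. (ii) For every $1\le i\le l$, the lists $z_{(1,i)},\dots,z_{(k_i,i)}$ and $z_{(1,i)}',\dots,z_{(k_i,i)}'$ are identical up to rearrangement. (iii) For every $x_{(j,i)}$ whose image in $\mathrm{Cent}_0(\sigma_i)/K_i\cong S_{k_i}$ is an $m$-cycle, there exists some $y_{(j',i)}$ whose image in $\mathrm{Cent}_0(\sigma_i)/K_i$ is also an $m$-cycle, such that for some integer $z_{j,i}$ the element $x_{(j,i)}^m$ is the product of the powers $\tau_{t,i}^{z_{j,i}}$ over the $m$ cycles $\tau_{t,i}$ moved by $x_{(j,i)}$, and $y_{(j',i)}^m$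 is the product of the powers $\tau_{t',i}^{z_{j,i}}$ (same exponent) over the $m$ cycles $\tau_{t',i}$ moved by $y_{(j',i)}$.
   Context: $S_n$ is the symmetric group of $\{1,\dots,n\}$ and $S_X$ that of a set $X$; for $X\subseteq\{1,\dots,n\}$, $S_X$ is regarded as a subgroup of $S_n$ (acting trivially outside $X$). $\mathbf{Fix}(\sigma)$ is the set of fixed points of $\sigma$ and $X_\sigma=\{1,\dots,n\}\setminus\mathbf{Fix}(\sigma)$. $\mathrm{Cent}_0(\sigma)$ denotes the centralizer of $\sigma$ in $S_{X_\sigma}$. Homomorphisms $\varphi,\psi:G\to H$ are generator-conjugate with respect to generators $g_1,\dots,g_r$ of $G$ if for each $i$ there is $h\in H$ (depending on $i$) with $h\varphi(g_i)h^{-1}=\psi(g_i)$. They are conjugate if there is a single $h\in H$ with $h\varphi(g)h^{-1}=\psi(g)$ for all $g\in G$. Write $\sigma=\sigma_1\cdots\sigma_l$, where $\sigma_i=\tau_{1,i}\tau_{2,i}\cdots\tau_{k_i,i}$ is a product of $k_i$ disjoint cycles of length $d_i$ (the nontrivial cycles of $\sigma$ grouped by length), and $d_1,\dots,d_l$ are all distinct. Since $\mathrm{Cent}_{S_n}(\sigma)=S_{\mathbf{Fix}(\sigma)}\times\mathrm{Cent}_0(\sigma_1)\times\cdots\times\mathrm{Cent}_0(\sigma_l)$ and $\varphi(b),\psi(b)$ commute with $\sigma$, one can write $\varphi(b)=\mu_0\pi_1\cdots\pi_l$ and $\psi(b)=\mu_0'\pi_1'\cdots\pi_l'$ with $\mu_0,\mu_0'\in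 S_{\mathbf{Fix}(\sigma)}$ and $\pi_i,\pi_i'\in\mathrm{Cent}_0(\sigma_i)$. Let $K_i=\langle\tau_{1,i},\dots,\tau_{k_i,i}\rangle$. The group $\mathrm{Cent}_0(\sigma_i)$ acts by conjugation on $\{\tau_{1,i},\dots,\tau_{k_i,i}\}$ with kernel $K_i$, giving $\mathrm{Cent}_0(\sigma_i)/K_i\cong S_{k_i}$. Write $\pi_i=\mu_i\pi_{0,i}$ and $\pi_i'=\mu_i'\pi_{0,i}'$, where $\mu_i,\mu_i'\in K_i$ and each of $\pi_{0,i},\pi_{0,i}'$, for every cycle $\tau_{j,i}$, either fixes all points of $\tau_{j,i}$ or sends all of them to some distinct cycle $\tau_{j',i}$. The $z_{(j,i)}$ and $z_{(j,i)}'$ are integers with $\mu_i=\tau_{1,i}^{z_{(1,i)}}\cdots\tau_{k_i,i}^{z_{(k_i,i)}}$ and $\mu_i'=\tau_{1,i}^{z_{(1,i)}'}\cdots\tau_{k_i,i}^{z_{(k_i,i)}'}$. Finally $\pi_{0,i}=x_{(1,i)}\cdots x_{(h,i)}$ and $\pi_{0,i}'=y_{(1,i)}\cdots y_{(h',i)}$ are decompositions into disjoint elements of $\mathrm{Cent}_0(\sigma_i)$ such that the image of every $x_{(j,i)}$ and every $y_{(j,i)}$ in $\mathrm{Cent}_0(\sigma_i)/K_i\cong S_{k_i}$ is a single cycle ($h,h'$ may depend on $i$). A cycle $\tau_{t,i}$ is moved by such an element if its index $t$ is moved by the image of that element in $S_{k_i}$.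
   Formalization: μ_i and π_{0,i} (likewise μ_i' and π_{0,i}') are required to be disjoint permutations; in (ii) the lists agree up to rearrangement modulo d_i; in (iii) distinct x_(j,i) are assigned distinct y_(j',i). Read literally, the equivalence is false. *)

theory Defs
  imports "HOL-Algebra.Algebra" "HOL-Number_Theory.Cong"
begin

definition conjugate_in :: "('a, 'm) monoid_scheme \<Rightarrow> 'a \<Rightarrow> 'a \<Rightarrow> bool" where
  "conjugate_in G g g' \<longleftrightarrow> (\<exists>h\<in>carrier G. h \<otimes>\<^bsub>G\<^esub> g \<otimes>\<^bsub>G\<^esub> inv\<^bsub>G\<^esub> h = g')"

definition generator_conjugate ::
    "('b, 'm) monoid_scheme \<Rightarrow> 'a list \<Rightarrow> ('a \<Rightarrow> 'b) \<Rightarrow> ('a \<Rightarrow> 'b) \<Rightarrow> bool" where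
  "generator_conjugate H gs \<phi> \<psi> \<longleftrightarrow> (\<forall>g\<in>set gs. conjugate_in H (\<phi> g) (\<psi> g))"

definition conjugate_homs ::
    "('a, 'k) monoid_scheme \<Rightarrow> ('b, 'm) monoid_scheme \<Rightarrow> ('a \<Rightarrow> 'b) \<Rightarrow> ('a \<Rightarrow> 'b) \<Rightarrow> bool" where
  "conjugate_homs G H \<phi> \<psi> \<longleftrightarrow>
     (\<exists>h\<in>carrier H. \<forall>g\<in>carrier G. h \<otimes>\<^bsub>H\<^esub> \<phi> g \<otimes>\<^bsub>H\<^esub> inv\<^bsub>H\<^esub> h = \<psi> g)"

text \<open>The ordered product f 1 \<open>\<otimes>\<close> \<open>\<dots>\<close> \<open>\<otimes>\<close> f k; the group need not be commutative.\<close>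

primrec gprod :: "('a, 'm) monoid_scheme \<Rightarrow> (nat \<Rightarrow> 'a) \<Rightarrow> nat \<Rightarrow> 'a" where
  "gprod G f 0 = \<one>\<^bsub>G\<^esub>"
| "gprod G f (Suc k) = gprod G f k \<otimes>\<^bsub>G\<^esub> f (Suc k)"

definition fixpts :: "nat \<Rightarrow> (nat \<Rightarrow> nat) \<Rightarrow> nat set" where
  "fixpts n p = {q \<in> {1..n}. p q = q}"

definition movpts :: "nat \<Rightarrow> (nat \<Rightarrow> nat) \<Rightarrow> nat set" where
  "movpts n p = {1..n} - fixpts n p"

definition disjoint_perms :: "nat \<Rightarrow> (nat \<Rightarrow> nat) \<Rightarrow> (nat \<Rightarrow> nat) \<Rightarrow> bool" where
  "disjoint_perms n p q \<longleftrightarrow> movpts n p \<inter> movpts n q = {}"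

definition cent0 :: "nat \<Rightarrow> (nat \<Rightarrow> nat) \<Rightarrow> (nat \<Rightarrow> nat) set" where
  "cent0 n s = {p. p permutes movpts n s \<and> p \<circ> s = s \<circ> p}"

text \<open>\<open>cycle_of_list\<close> sends lists of length 0 and 1 to the identity, which is not a cycle here.\<close>

definition is_cycle :: "nat \<Rightarrow> (nat \<Rightarrow> nat) \<Rightarrow> bool" where
  "is_cycle m p \<longleftrightarrow> m \<ge> 2 \<and> (\<exists>cs. cycle cs \<and> length cs = m \<and> p = cycle_of_list cs)"

text \<open>
  The cycle called tau with index pair (j, i) in the mathematical notation is \<open>\<tau> i j\<close>,
  and similarly for the exponents z and the factors x, y: the index i of the
  cycle length comes first.
\<close>

definition cycle_block :: "nat \<Rightarrow> (nat \<Rightarrow> nat) \<Rightarrow> (nat \<Rightarrow> nat \<Rightarrow> nat \<Rightarrow> nat) \<Rightarrow> nat \<Rightarrow> nat \<Rightarrow> nat" where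
  "cycle_block n k \<tau> i = gprod (sym_group n) (\<tau> i) (k i)"

definition cycle_grouping ::
    "nat \<Rightarrow> (nat \<Rightarrow> nat) \<Rightarrow> nat \<Rightarrow> (nat \<Rightarrow> nat) \<Rightarrow> (nat \<Rightarrow> nat) \<Rightarrow> (nat \<Rightarrow> nat \<Rightarrow> nat \<Rightarrow> nat) \<Rightarrow> bool" where
  "cycle_grouping n \<sigma> l k d \<tau> \<longleftrightarrow>
     inj_on d {1..l} \<and>
     (\<forall>i\<in>{1..l}. k i \<ge> 1) \<and>
     (\<forall>i\<in>{1..l}. \<forall>j\<in>{1..k i}. \<tau> i j \<in> carrier (sym_group n) \<and> is_cycle (d i) (\<tau> i j)) \<and>
     (\<forall>i\<in>{1..l}. \<forall>j\<in>{1..k i}. \<forall>i'\<in>{1..l}. \<forall>j'\<in>{1..k i'}.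
        (i, j) \<noteq> (i', j') \<longrightarrow> disjoint_perms n (\<tau> i j) (\<tau> i' j')) \<and>
     \<sigma> = gprod (sym_group n) (cycle_block n k \<tau>) l"

text \<open>
  For disjoint cycles T 1, \<open>\<dots>\<close>, T k of equal length and x in the centralizer
  Cent0 of their product, \<open>cent_image n k T x\<close> is the image of x under
  Cent0 / K \<open>\<cong>\<close> S_k, that is, the permutation of the indices 1, \<open>\<dots>\<close>, k
  induced by conjugation of the cycles with x.
\<close>

definition cent_image :: "nat \<Rightarrow> nat \<Rightarrow> (nat \<Rightarrow> nat \<Rightarrow> nat) \<Rightarrow> (nat \<Rightarrow> nat) \<Rightarrow> nat \<Rightarrow> nat" where
  "cent_image n k T x = (\<lambda>t. if t \<in> {1..k}
     then (THE s. s \<in> {1..k} \<and> x \<otimes>\<^bsub>sym_group n\<^esub> T t \<otimes>\<^bsub>sym_group n\<^esub> inv\<^bsub>sym_group n\<^esub> x = T s)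
     else t)"

definition moved_cycles :: "nat \<Rightarrow> nat \<Rightarrow> (nat \<Rightarrow> nat \<Rightarrow> nat) \<Rightarrow> (nat \<Rightarrow> nat) \<Rightarrow> nat set" where
  "moved_cycles n k T x = {t \<in> {1..k}. cent_image n k T x t \<noteq> t}"

text \<open>
  The decomposition of an element \<open>\<rho>\<close> of the centralizer of \<open>\<sigma>\<close>.
  The factors \<open>\<mu> i\<close> and \<open>\<pi>0 i\<close> of \<open>\<pi> i\<close> are disjoint: \<open>\<mu> i\<close> is the part of \<open>\<pi> i\<close> on the cycles
  which \<open>\<pi> i\<close> maps to themselves. Without disjointness \<open>\<mu> i\<close> would be arbitrary on
  the cycles moved by \<open>\<pi> i\<close>.
\<close>

definition cent_decomp ::
    "nat \<Rightarrow> (nat \<Rightarrow> nat) \<Rightarrow> nat \<Rightarrow> (nat \<Rightarrow> nat) \<Rightarrow> (nat \<Rightarrow> nat \<Rightarrow> nat \<Rightarrow> nat) \<Rightarrow> (nat \<Rightarrow> nat) \<Rightarrow>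
     (nat \<Rightarrow> nat) \<Rightarrow> (nat \<Rightarrow> nat \<Rightarrow> nat) \<Rightarrow> (nat \<Rightarrow> nat \<Rightarrow> nat) \<Rightarrow> (nat \<Rightarrow> nat \<Rightarrow> nat) \<Rightarrow>
     (nat \<Rightarrow> nat \<Rightarrow> int) \<Rightarrow> (nat \<Rightarrow> nat) \<Rightarrow> (nat \<Rightarrow> nat \<Rightarrow> nat \<Rightarrow> nat) \<Rightarrow> bool" where
  "cent_decomp n \<sigma> l k \<tau> \<rho> \<mu>0 \<pi> \<mu> \<pi>0 z h x \<longleftrightarrow>
     \<mu>0 permutes fixpts n \<sigma> \<and>
     (\<forall>i\<in>{1..l}. \<pi> i \<in> cent0 n (cycle_block n k \<tau> i)) \<and>
     \<rho> = \<mu>0 \<otimes>\<^bsub>sym_group n\<^esub> gprod (sym_group n) \<pi> l \<and>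
     (\<forall>i\<in>{1..l}.
        \<pi> i = \<mu> i \<otimes>\<^bsub>sym_group n\<^esub> \<pi>0 i \<and>
        \<mu> i \<in> generate (sym_group n) (\<tau> i ` {1..k i}) \<and>
        (\<forall>j\<in>{1..k i}.
           (\<forall>q\<in>movpts n (\<tau> i j). \<pi>0 i q = q) \<or>
           (\<exists>j'\<in>{1..k i}. j' \<noteq> j \<and> \<pi>0 i ` movpts n (\<tau> i j) \<subseteq> movpts n (\<tau> i j'))) \<and>
        disjoint_perms n (\<mu> i) (\<pi>0 i) \<and>
        \<mu> i = gprod (sym_group n) (\<lambda>j. \<tau> i j [^]\<^bsub>sym_group n\<^esub> z i j) (k i) \<and>
        (\<forall>j\<in>{1..h i}. x i j \<in> cent0 n (cycle_block n k \<tau> i)) \<and>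
        (\<forall>j\<in>{1..h i}. \<exists>m. is_cycle m (cent_image n (k i) (\<tau> i) (x i j))) \<and>
        (\<forall>j\<in>{1..h i}. \<forall>j'\<in>{1..h i}. j \<noteq> j' \<longrightarrow> disjoint_perms n (x i j) (x i j')) \<and>
        \<pi>0 i = gprod (sym_group n) (x i) (h i))"

text \<open>
  \<open>power_on_moved n k T x m c\<close>: the m-th power of x is the product of the powers
  (T t)^c over the cycles T t moved by x.
\<close>

definition power_on_moved ::
    "nat \<Rightarrow> nat \<Rightarrow> (nat \<Rightarrow> nat \<Rightarrow> nat) \<Rightarrow> (nat \<Rightarrow> nat) \<Rightarrow> nat \<Rightarrow> int \<Rightarrow> bool" where
  "power_on_moved n k T x m c \<longleftrightarrow>
     x [^]\<^bsub>sym_group n\<^esub> m =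
     gprod (sym_group n)
       (\<lambda>t. if t \<in> moved_cycles n k T x then T t [^]\<^bsub>sym_group n\<^esub> c else \<one>\<^bsub>sym_group n\<^esub>) k"

end

theory Submission
  imports Defs
begin

text \<open>
  Two homomorphisms from an abelian group with generators \<open>a, b\<close> are conjugate precisely if
  one permutation intertwines both \<open>\<sigma>\<close> with itself and \<open>\<phi> b\<close> with \<open>\<psi> b\<close>
  (\<open>conjugate_homs_sym_group\<close>). Commuting permutations \<open>\<sigma>, \<beta>\<close> make the points into a set with an
  action of the free abelian group of rank two, and a transitive such set is
  determined by the stabilizer of any of its points; as the group is abelian, all points of an orbit
  have the same stabilizer. Hence two actions on finite sets are isomorphic as soon as, for every
  possible stabilizer, equally many points have it. This is \<open>equivariant_bij_exists\<close>, where the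
  stabilizer is replaced by the set of \<open>coincidences\<close>, which only uses nonnegative exponents. Since
  this criterion counts points, it is additive over the fixed points of \<open>\<sigma>\<close> and the
  cycle lengths of \<open>\<sigma>\<close>.

  On the cycles of one length \<open>d\<close> the orbits are of two kinds. A cycle mapped to itself is an
  orbit on which \<open>\<beta> = \<sigma>\<^sup>z\<close>. The \<open>m\<close> cycles moved by one factor \<open>x\<close> form an
  orbit on which \<open>\<beta>\<^sup>m = \<sigma>\<^sup>c\<close> and no smaller positive power of \<open>\<beta>\<close> preserves a cycle. In
  both cases the coincidences are an explicit function of \<open>(d, m, c mod d)\<close>, with \<open>m = 1\<close> for the
  first kind (\<open>coincidences_unmoved\<close>, \<open>coincidences_moved\<close>), so the three conditions
  of the theorem determine all the counts.

  There is one gap to fill. The moved cycles enter the exponent lists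
  of the second condition with exponents divisible by the cycle length, and the third condition only provides an injection from the
  factors \<open>x\<close> to the factors \<open>y\<close>. So, a priori, \<open>\<psi> b\<close> might move more cycles than \<open>\<phi> b\<close>, at the
  expense of cycles that are fixed pointwise. Here generator-conjugacy is used: \<open>\<phi> b\<close> and
  \<open>\<psi> b\<close> have equally many fixed points. The fixed points on cycles of length \<open>d\<close> number
  \<open>d\<close> times the difference between the number of exponents divisible by \<open>d\<close> and the number of moved cycles
  (\<open>card_fixed_points\<close>); summing over all lengths shows that the injections
  are bijections.

  Conversely, a conjugating permutation permutes the cycles of \<open>\<sigma>\<close> of each length and carries the
  orbits of \<open>\<phi> b\<close> to those of \<open>\<psi> b\<close>; the induced permutation of the indices witnesses the second
  condition, and the induced map of orbits the third (\<open>block_invariants\<close>).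
\<close>

section \<open>Finite sets with two commuting permutations\<close>

lemma funpow_comm: "s \<circ> t = t \<circ> s \<Longrightarrow> (s ^^ u) ((t ^^ v) q) = (t ^^ v) ((s ^^ u) q)"
proof -
  assume c: "s \<circ> t = t \<circ> s"
  have 1: "s ((t ^^ v) q) = (t ^^ v) (s q)" for q
    using c by (induction v arbitrary: q) (auto simp: fun_eq_iff)
  show ?thesis by (induction u arbitrary: q) (auto simp: 1)
qed

text \<open>
  Since inverses of permutations of a finite set are powers of them, the coincidences at \<open>q\<close> carry
  the same information as the stabilizer of \<open>q\<close> under the action of the free abelian group of rank
  two; nonnegative exponents suffice to record it.
\<close>
definition coincidences :: "('p \<Rightarrow> 'p) \<Rightarrow> ('p \<Rightarrow> 'p) \<Rightarrow> 'p \<Rightarrow> (nat \<times> nat \<times> nat \<times> nat) set" where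
  "coincidences s t q = {(u, v, u', v'). (s ^^ u) ((t ^^ v) q) = (s ^^ u') ((t ^^ v') q)}"

text \<open>
  All points of an orbit of an abelian group have the same stabilizer: by commutativity the element that
  moved the base point comes out in front of both sides of a coincidence, and injectivity cancels it.
\<close>
lemma coincidences_funpow:
  assumes "inj s" "inj t" "s \<circ> t = t \<circ> s"
  shows "coincidences s t ((s ^^ i) ((t ^^ j) q)) = coincidences s t q"
proof -
  have c: "(s ^^ u) ((t ^^ v) ((s ^^ i) ((t ^^ j) q))) = (s ^^ i) ((t ^^ j) ((s ^^ u) ((t ^^ v) q)))" for u v
  proof -
    have ss: "(s ^^ u) ((s ^^ i) p) = (s ^^ i) ((s ^^ u) p)"
      and tt: "(t ^^ v) ((t ^^ j) p) = (t ^^ j) ((t ^^ v) p)" for p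
      by (metis add.commute comp_apply funpow_add)+
    note st = funpow_comm[OF assms(3)]
    have "(t ^^ v) ((s ^^ i) ((t ^^ j) q)) = (s ^^ i) ((t ^^ j) ((t ^^ v) q))"
      by (simp only: st[symmetric] tt)
    then show ?thesis by (simp only: ss st)
  qed
  have "inj (\<lambda>p. (s ^^ i) ((t ^^ j) p))"
    using assms inj_compose[OF inj_fn[of s i] inj_fn[of t j]] by (simp add: comp_def)
  from inj_eq[OF this] show ?thesis unfolding coincidences_def c by simp
qed

definition joint_orbit :: "('p \<Rightarrow> 'p) \<Rightarrow> ('p \<Rightarrow> 'p) \<Rightarrow> 'p \<Rightarrow> 'p set" where
  "joint_orbit s t q = {(s ^^ u) ((t ^^ v) q) | u v. True}"

lemma joint_orbit_closed:
  assumes "s \<circ> t = t \<circ> s" and "p \<in> joint_orbit s t q"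
  shows "s p \<in> joint_orbit s t q" and "t p \<in> joint_orbit s t q"
proof -
  obtain u v where p: "p = (s ^^ u) ((t ^^ v) q)"
    using assms(2) by (auto simp: joint_orbit_def)
  have "s p = (s ^^ Suc u) ((t ^^ v) q)" by (simp add: p)
  then show "s p \<in> joint_orbit s t q" unfolding joint_orbit_def by blast
  have "t p = (s ^^ u) ((t ^^ Suc v) q)"
    using funpow_comm[OF assms(1), of u 1] by (simp add: p)
  then show "t p \<in> joint_orbit s t q" unfolding joint_orbit_def by blast
qed

lemma joint_orbit_subset:
  assumes "s ` P \<subseteq> P" and "t ` P \<subseteq> P" and "q \<in> P"
  shows "joint_orbit s t q \<subseteq> P"
proof -
  have "(t ^^ v) q \<in> P" for v using assms by (induction v) auto
  then have "(s ^^ u) ((t ^^ v) q) \<in> P" for u v using assms by (induction u) auto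
  then show ?thesis by (auto simp: joint_orbit_def)
qed

lemma coincidences_joint_orbit:
  assumes "inj s" "inj t" "s \<circ> t = t \<circ> s" "p \<in> joint_orbit s t q"
  shows "coincidences s t p = coincidences s t q"
proof -
  obtain u v where "p = (s ^^ u) ((t ^^ v) q)" using assms(4) by (auto simp: joint_orbit_def)
  then show ?thesis using coincidences_funpow[OF assms(1-3)] by metis
qed

text \<open>
  A transitive set is determined by a stabilizer: \<open>s\<^sup>u t\<^sup>v q \<mapsto> s'\<^sup>u t'\<^sup>v q'\<close> is well defined because the
  coincidences at \<open>q\<close> are coincidences at \<open>q'\<close>, and injective because of the converse.
\<close>
lemma joint_orbit_equivariant_bij:
  fixes s t :: "'p \<Rightarrow> 'p" and s' t' :: "'r \<Rightarrow> 'r"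
  assumes "s \<circ> t = t \<circ> s" and "s' \<circ> t' = t' \<circ> s'"
    and T: "coincidences s t q = coincidences s' t' q'"
  shows "\<exists>g. bij_betw g (joint_orbit s t q) (joint_orbit s' t' q') \<and>
    (\<forall>p\<in>joint_orbit s t q. g (s p) = s' (g p) \<and> g (t p) = t' (g p))"
proof -
  have e: "(s ^^ u) ((t ^^ v) q) = (s ^^ u') ((t ^^ v') q) \<longleftrightarrow>
      (s' ^^ u) ((t' ^^ v) q') = (s' ^^ u') ((t' ^^ v') q')" for u v u' v'
  proof -
    have "(u, v, u', v') \<in> coincidences s t q \<longleftrightarrow> (u, v, u', v') \<in> coincidences s' t' q'"
      using T by simp
    then show ?thesis by (simp add: coincidences_def)
  qed
  (* The exponents chosen for p do not matter: any two choices coincide at q, hence at q'. *)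
  define g where "g p = (let (u, v) = (SOME (u, v). p = (s ^^ u) ((t ^^ v) q))
      in (s' ^^ u) ((t' ^^ v) q'))" for p
  have g: "g ((s ^^ u) ((t ^^ v) q)) = (s' ^^ u) ((t' ^^ v) q')" for u v
  proof -
    obtain a b where w: "(SOME (u', v'). (s ^^ u) ((t ^^ v) q) = (s ^^ u') ((t ^^ v') q)) = (a, b)"
      by fastforce
    have "case (a, b) of (u', v') \<Rightarrow> (s ^^ u) ((t ^^ v) q) = (s ^^ u') ((t ^^ v') q)"
      unfolding w[symmetric] by (rule someI[of _ "(u, v)"]) simp
    then have "(s ^^ u) ((t ^^ v) q) = (s ^^ a) ((t ^^ b) q)" by simp
    then have "(s' ^^ u) ((t' ^^ v) q') = (s' ^^ a) ((t' ^^ b) q')" by (simp only: e)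
    then show ?thesis unfolding g_def w Let_def by simp
  qed
  have "bij_betw g (joint_orbit s t q) (joint_orbit s' t' q')"
    unfolding bij_betw_def
  proof
    show "inj_on g (joint_orbit s t q)"
    proof (rule inj_onI)
      fix p p' assume "p \<in> joint_orbit s t q" "p' \<in> joint_orbit s t q" "g p = g p'"
      then obtain u v u' v' where p: "p = (s ^^ u) ((t ^^ v) q)" "p' = (s ^^ u') ((t ^^ v') q)"
        and "g p = g p'"
        unfolding joint_orbit_def by blast
      then show "p = p'" by (simp only: p g e)
    qed
    show "g ` joint_orbit s t q = joint_orbit s' t' q'"
    proof
      show "g ` joint_orbit s t q \<subseteq> joint_orbit s' t' q'"
      proof
        fix r assume "r \<in> g ` joint_orbit s t q"
        then obtain u v where "r = g ((s ^^ u) ((t ^^ v) q))" unfolding joint_orbit_def by blast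
        then show "r \<in> joint_orbit s' t' q'" unfolding g joint_orbit_def by blast
      qed
      show "joint_orbit s' t' q' \<subseteq> g ` joint_orbit s t q"
      proof
        fix r assume "r \<in> joint_orbit s' t' q'"
        then obtain u v where "r = g ((s ^^ u) ((t ^^ v) q))" unfolding joint_orbit_def g by blast
        then show "r \<in> g ` joint_orbit s t q" unfolding joint_orbit_def by blast
      qed
    qed
  qed
  moreover have "g (s p) = s' (g p) \<and> g (t p) = t' (g p)" if p_in: "p \<in> joint_orbit s t q" for p
  proof -
    obtain u v where p: "p = (s ^^ u) ((t ^^ v) q)"
      using p_in unfolding joint_orbit_def by blast
    have "s p = (s ^^ Suc u) ((t ^^ v) q)" by (simp add: p)
    then have "g (s p) = s' (g p)" unfolding p by (simp only: g) simp
    moreover have "t p = (s ^^ u) ((t ^^ Suc v) q)"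
      using funpow_comm[OF assms(1), of u 1] by (simp add: p)
    then have "g (t p) = t' (g p)"
      using funpow_comm[OF assms(2), of u 1] unfolding p by (simp only: g) simp
    ultimately show ?thesis ..
  qed
  ultimately show ?thesis by blast
qed

text \<open>
  All points of the removed orbit share one set of coincidences, so only one of the counts changes, and it
  drops by the size of the orbit.
\<close>
lemma card_coincidences_diff:
  assumes "finite P" "inj s" "inj t" "s \<circ> t = t \<circ> s" "joint_orbit s t q \<subseteq> P"
  shows "card {p \<in> P - joint_orbit s t q. coincidences s t p = T} =
    card {p \<in> P. coincidences s t p = T} -
    (if coincidences s t q = T then card (joint_orbit s t q) else 0)"
proof (cases "coincidences s t q = T")
  case True
  then have "{p \<in> P - joint_orbit s t q. coincidences s t p = T} =
      {p \<in> P. coincidences s t p = T} - joint_orbit s t q" by auto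
  moreover have "joint_orbit s t q \<subseteq> {p \<in> P. coincidences s t p = T}"
    using True assms(5) coincidences_joint_orbit[OF assms(2-4)] by auto
  moreover have "finite (joint_orbit s t q)" using assms finite_subset by blast
  ultimately show ?thesis using True by (simp add: card_Diff_subset)
next
  case False
  then have "{p \<in> P - joint_orbit s t q. coincidences s t p = T} = {p \<in> P. coincidences s t p = T}"
    using coincidences_joint_orbit[OF assms(2-4)] by auto
  then show ?thesis using False by simp
qed

text \<open>
  An injective map of the finite orbit into itself is onto, so it cannot map anything else into the orbit.
\<close>
lemma diff_joint_orbit_closed:
  assumes "finite P" "inj s" "inj t" "s \<circ> t = t \<circ> s" "s ` P \<subseteq> P" "t ` P \<subseteq> P" "q \<in> P"
  shows "s ` (P - joint_orbit s t q) \<subseteq> P - joint_orbit s t q"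
    and "t ` (P - joint_orbit s t q) \<subseteq> P - joint_orbit s t q"
proof -
  have fin: "finite (joint_orbit s t q)"
    using joint_orbit_subset[OF assms(5-7)] assms(1) finite_subset by blast
  have "s ` joint_orbit s t q = joint_orbit s t q" "t ` joint_orbit s t q = joint_orbit s t q"
    using joint_orbit_closed[OF assms(4)] inj_on_subset[OF assms(2)] inj_on_subset[OF assms(3)]
    by (auto intro!: endo_inj_surj[OF fin])
  then show "s ` (P - joint_orbit s t q) \<subseteq> P - joint_orbit s t q"
    and "t ` (P - joint_orbit s t q) \<subseteq> P - joint_orbit s t q"
    using assms(2,3,5,6) by (auto simp: image_set_diff)
qed

text \<open>
  An orbit in \<open>P\<close> and an orbit in \<open>Q\<close> with the same coincidences are isomorphic; removing both keeps the
  counts equal, so induction on the size of \<open>P\<close> matches the rest. Asking for equal numbers of points,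
  instead of orbits, is enough because isomorphic orbits have equally many points.
\<close>
lemma equivariant_bij_exists:
  fixes s t :: "'p \<Rightarrow> 'p" and s' t' :: "'r \<Rightarrow> 'r"
  assumes "finite P" and "finite Q"
    and st: "inj s" "inj t" "s \<circ> t = t \<circ> s" and P: "s ` P \<subseteq> P" "t ` P \<subseteq> P"
    and st': "inj s'" "inj t'" "s' \<circ> t' = t' \<circ> s'" and Q: "s' ` Q \<subseteq> Q" "t' ` Q \<subseteq> Q"
    and cnt: "\<And>T. card {q \<in> P. coincidences s t q = T} = card {q \<in> Q. coincidences s' t' q = T}"
  shows "\<exists>h. bij_betw h P Q \<and> (\<forall>q\<in>P. h (s q) = s' (h q) \<and> h (t q) = t' (h q))"
  using assms(1,2) P Q cnt
proof (induction P arbitrary: Q rule: finite_psubset_induct)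
  case (psubset P)
  show ?case
  proof (cases "P = {}")
    case True
    have "y \<notin> Q" for y
    proof
      assume "y \<in> Q"
      then have "y \<in> {q \<in> Q. coincidences s' t' q = coincidences s' t' y}" by simp
      moreover have "card {q \<in> Q. coincidences s' t' q = coincidences s' t' y} = 0"
        using psubset.prems(6)[of "coincidences s' t' y"] True by simp
      ultimately show False using psubset.prems(1) by auto
    qed
    then show ?thesis using True by (auto simp: bij_betw_def)
  next
    case False
    then obtain q where q: "q \<in> P" by blast
    let ?T = "coincidences s t q"
    have "card {p \<in> P. coincidences s t p = ?T} \<noteq> 0" using q psubset.hyps by auto
    then have "card {p \<in> Q. coincidences s' t' p = ?T} \<noteq> 0" using psubset.prems(6) by simp
    then have "{p \<in> Q. coincidences s' t' p = ?T} \<noteq> {}" by force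
    then obtain q' where q': "q' \<in> Q" "coincidences s' t' q' = ?T" by auto
    let ?O = "joint_orbit s t q" and ?O' = "joint_orbit s' t' q'"
    obtain g where g: "bij_betw g ?O ?O'" "\<forall>p\<in>?O. g (s p) = s' (g p) \<and> g (t p) = t' (g p)"
      using joint_orbit_equivariant_bij[OF st(3) st'(3)] q'(2) by metis
    have O: "?O \<subseteq> P" "?O' \<subseteq> Q"
      using joint_orbit_subset psubset.prems q q'(1) by metis+
    have "q \<in> ?O" unfolding joint_orbit_def by (auto intro!: exI[of _ 0])
    then have "P - ?O \<subset> P" using q by blast
    note IH = psubset.IH[OF this]
    have closed: "s ` (P - ?O) \<subseteq> P - ?O" "t ` (P - ?O) \<subseteq> P - ?O"
      using diff_joint_orbit_closed[OF psubset.hyps st psubset.prems(2,3) q] by auto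
    have closed': "s' ` (Q - ?O') \<subseteq> Q - ?O'" "t' ` (Q - ?O') \<subseteq> Q - ?O'"
      using diff_joint_orbit_closed[OF psubset.prems(1) st' psubset.prems(4,5) q'(1)] by auto
    have "\<exists>h. bij_betw h (P - ?O) (Q - ?O') \<and>
        (\<forall>q\<in>P - ?O. h (s q) = s' (h q) \<and> h (t q) = t' (h q))"
    proof (rule IH[OF _ closed closed'])
      show "finite (Q - ?O')" using psubset.prems(1) by simp
      show "card {p \<in> P - ?O. coincidences s t p = T} =
          card {p \<in> Q - ?O'. coincidences s' t' p = T}" for T
        unfolding card_coincidences_diff[OF psubset.hyps st O(1)]
          card_coincidences_diff[OF psubset.prems(1) st' O(2)] q'(2)
          psubset.prems(6) bij_betw_same_card[OF g(1)] by simp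
    qed
    then obtain h where h: "bij_betw h (P - ?O) (Q - ?O')"
      "\<forall>q\<in>P - ?O. h (s q) = s' (h q) \<and> h (t q) = t' (h q)" by blast
    define w where "w p = (if p \<in> ?O then g p else h p)" for p
    have "bij_betw w (?O \<union> (P - ?O)) (?O' \<union> (Q - ?O'))"
      unfolding w_def by (rule bij_betw_disjoint_Un[OF g(1) h(1)]) auto
    then have "bij_betw w P Q" using O by (simp add: Un_absorb1 Un_Diff_cancel)
    moreover have "w (s p) = s' (w p) \<and> w (t p) = t' (w p)" if "p \<in> P" for p
    proof (cases "p \<in> ?O")
      case True
      then show ?thesis using joint_orbit_closed[OF st(3) True] g(2) by (simp add: w_def)
    next
      case False
      then have "s p \<notin> ?O" "t p \<notin> ?O" using closed that by blast+
      then show ?thesis using h(2) False that by (simp add: w_def)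
    qed
    ultimately show ?thesis by blast
  qed
qed

section \<open>Cyclic permutations of a finite set\<close>

text \<open>
  A single cycle of \<open>p\<close> with point set \<open>S\<close>, described by the period of its points. Transitivity follows by
  counting: an orbit of \<open>card S\<close> points in \<open>S\<close> exhausts \<open>S\<close> (\<open>rotates_reach\<close>).
\<close>
definition rotates :: "('p \<Rightarrow> 'p) \<Rightarrow> 'p set \<Rightarrow> bool" where
  "rotates p S \<longleftrightarrow> finite S \<and> S \<noteq> {} \<and> (\<forall>q\<in>S. p q \<in> S \<and>
     (\<forall>u v. (p ^^ u) q = (p ^^ v) q \<longleftrightarrow> u mod card S = v mod card S))"

lemma rotates_funpow_in: "rotates p S \<Longrightarrow> q \<in> S \<Longrightarrow> (p ^^ u) q \<in> S"
  by (induction u) (simp_all add: rotates_def)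

lemma rotates_funpow_eq:
  "rotates p S \<Longrightarrow> q \<in> S \<Longrightarrow> (p ^^ u) q = (p ^^ v) q \<longleftrightarrow> u mod card S = v mod card S"
  unfolding rotates_def by blast

lemma rotates_reach:
  assumes "rotates p S" "q \<in> S" "q' \<in> S"
  shows "\<exists>u. q' = (p ^^ u) q"
proof -
  have "inj_on (\<lambda>u. (p ^^ u) q) {..<card S}"
    by (rule inj_onI) (simp add: rotates_funpow_eq[OF assms(1,2)])
  then have "card ((\<lambda>u. (p ^^ u) q) ` {..<card S}) = card S"
    by (simp add: card_image)
  moreover have "(\<lambda>u. (p ^^ u) q) ` {..<card S} \<subseteq> S"
    using rotates_funpow_in[OF assms(1,2)] by auto
  ultimately have "(\<lambda>u. (p ^^ u) q) ` {..<card S} = S"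
    using assms(1) unfolding rotates_def by (meson card_subset_eq)
  then show ?thesis using assms(3) by auto
qed

lemma rotates_cong:
  assumes "rotates p S" "\<And>q. q \<in> S \<Longrightarrow> p' q = p q"
  shows "rotates p' S"
proof -
  have "(p' ^^ u) q = (p ^^ u) q" if "q \<in> S" for q u
    using that assms(2) rotates_funpow_in[OF assms(1)] by (induction u) auto
  then show ?thesis using assms unfolding rotates_def by simp
qed

text \<open>
  The power with exponent \<open>u\<close> of the cycle given by a list sends each entry to the entry \<open>u\<close> places
  further on, so the residues of the exponents modulo the length decide equality.
\<close>
lemma is_cycle_rotates:
  assumes "is_cycle m p"
  shows "rotates p {q. p q \<noteq> q}" "card {q. p q \<noteq> q} = m" "m \<ge> 2"
proof -
  obtain cs where cs: "cycle cs" "length cs = m" "p = cycle_of_list cs" "m \<ge> 2"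
    using assms by (auto simp: is_cycle_def)
  have nth: "(p ^^ u) (cs ! i) = cs ! ((u + i) mod m)" if "i < m" for u i
  proof -
    have "map (p ^^ u) cs = rotate u cs" using cyclic_rotation[OF cs(1)] cs(3) by simp
    then have "map (p ^^ u) cs ! i = rotate u cs ! i" by simp
    then show ?thesis using that cs(2) by (simp add: nth_rotate)
  qed
  have eq: "(p ^^ u) q = (p ^^ v) q \<longleftrightarrow> u mod m = v mod m" if q: "q \<in> set cs" for u v q
  proof -
    obtain i where i: "i < m" "q = cs ! i" using q cs(2) by (auto simp: in_set_conv_nth)
    have "(p ^^ u) q = (p ^^ v) q \<longleftrightarrow> (u + i) mod m = (v + i) mod m"
      unfolding i(2) nth[OF i(1)] using cs by (simp add: nth_eq_iff_index_eq)
    also have "\<dots> \<longleftrightarrow> u mod m = v mod m"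
      using cong_add_rcancel_nat[of u i v m] by (simp add: cong_def)
    finally show ?thesis .
  qed
  have supp: "{q. p q \<noteq> q} = set cs"
  proof -
    have "p q \<noteq> q" if "q \<in> set cs" for q
      using eq[OF that, of 1 0] cs(4) by auto
    moreover have "p q = q" if "q \<notin> set cs" for q
      using that cs(3) by (simp add: id_outside_supp)
    ultimately show ?thesis by auto
  qed
  have c: "card (set cs) = m" using cs distinct_card by blast
  show "card {q. p q \<noteq> q} = m" "m \<ge> 2" using supp c cs(4) by auto
  have "p q \<in> set cs" if q: "q \<in> set cs" for q
  proof -
    obtain i where i: "i < m" "q = cs ! i" using q cs(2) by (auto simp: in_set_conv_nth)
    then show ?thesis using nth[OF i(1), of 1] cs by simp
  qed
  then show "rotates p {q. p q \<noteq> q}"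
    unfolding supp rotates_def c using eq cs(2,4) by auto
qed

section \<open>Two commuting permutations on the cycles of one length\<close>

text \<open>
  Splitting \<open>v\<close> into \<open>v mod m\<close> and \<open>m * (v div m)\<close> and replacing \<open>t\<^sup>m\<close> by \<open>s\<^sup>c\<close> brings \<open>s\<^sup>u t\<^sup>v q\<close> to a
  normal form, a power of \<open>t\<close> below \<open>m\<close> applied to a power of \<open>s\<close>. The assumption \<open>first_return\<close> separates
  different powers of \<open>t\<close>, and the period compares the exponents of \<open>s\<close>.
\<close>
lemma coincidences_eqI:
  fixes c d m :: nat
  assumes "inj s" "inj t" and st: "s \<circ> t = t \<circ> s" and "m > 0"
    and period: "\<And>u v. (s ^^ u) q = (s ^^ v) q \<longleftrightarrow> u mod d = v mod d"
    and return: "(t ^^ m) q = (s ^^ c) q"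
    and first_return: "\<And>u v u' v'. (s ^^ u) ((t ^^ v) q) = (s ^^ u') ((t ^^ v') q) \<Longrightarrow> v mod m = v' mod m"
  shows "coincidences s t q = {(u, v, u', v'). v mod m = v' mod m \<and>
    (u + c * (v div m)) mod d = (u' + c * (v' div m)) mod d}"
proof -
  note comm = funpow_comm[OF st]
  have rounds: "(t ^^ (m * w)) q = (s ^^ (c * w)) q" for w
  proof (induction w)
    case (Suc w)
    have "(t ^^ (m * Suc w)) q = (t ^^ m) ((t ^^ (m * w)) q)"
      by (simp add: funpow_add)
    also have "\<dots> = (s ^^ (c * w)) ((s ^^ c) q)" by (simp only: Suc comm[symmetric] return)
    also have "\<dots> = (s ^^ (c * Suc w)) q"
      by (simp add: funpow_add[symmetric] add.commute flip: comp_apply[of "s ^^ (c * w)"])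
    finally show ?case .
  qed simp
  have normal: "(s ^^ u) ((t ^^ v) q) = (t ^^ (v mod m)) ((s ^^ (u + c * (v div m))) q)" for u v
  proof -
    have "(t ^^ v) q = (t ^^ (v mod m)) ((t ^^ (m * (v div m))) q)"
      unfolding comp_apply[symmetric, of "t ^^ (v mod m)"] funpow_add[symmetric] by simp
    then have "(s ^^ u) ((t ^^ v) q) = (t ^^ (v mod m)) ((s ^^ u) ((s ^^ (c * (v div m))) q))"
      by (simp only: rounds comm)
    then show ?thesis by (simp add: funpow_add)
  qed
  have "(s ^^ u) ((t ^^ v) q) = (s ^^ u') ((t ^^ v') q) \<longleftrightarrow> v mod m = v' mod m \<and>
    (u + c * (v div m)) mod d = (u' + c * (v' div m)) mod d" for u v u' v'
  proof (cases "v mod m = v' mod m")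
    case True
    have "inj (t ^^ (v' mod m))" using assms(2) by (rule inj_fn)
    from inj_eq[OF this] True show ?thesis unfolding normal by (simp only: period simp_thms)
  next
    case False
    then show ?thesis using first_return by blast
  qed
  then show ?thesis unfolding coincidences_def by simp
qed

text \<open>
  The coincidences at a point whose stabilizer is the lattice spanned by \<open>(d, 0)\<close> and \<open>(-c, m)\<close>.
\<close>
definition lattice_coincidences :: "nat \<Rightarrow> nat \<Rightarrow> nat \<Rightarrow> (nat \<times> nat \<times> nat \<times> nat) set" where
  "lattice_coincidences d m c = {(u, v, u', v'). v mod m = v' mod m \<and>
    (u + c * (v div m)) mod d = (u' + c * (v' div m)) mod d}"

lemma lattice_coincidences_mod:
  assumes "c mod d = c' mod d"
  shows "lattice_coincidences d m c = lattice_coincidences d m c'"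
proof -
  have "(u + c * w) mod d = (u + c' * w) mod d" for u w
    using assms by (metis mod_add_right_eq mod_mult_left_eq)
  then show ?thesis unfolding lattice_coincidences_def by simp
qed

text \<open>
  The sets \<open>C 1, \<dots>, C k\<close> are the cycles of one length \<open>d\<close> of \<open>s\<close>. A commuting permutation \<open>b\<close> permutes
  them; the index sets \<open>M t\<close> are the nontrivial cycles \<open>g t\<close> of the induced permutation of indices. On a
  cycle that is mapped to itself, \<open>b\<close> is a power of \<open>s\<close>. On the moved cycles the exponents \<open>z\<close>
  vanish modulo \<open>d\<close>, as in the list of exponents of the factor \<open>\<mu>\<close>.
\<close>
locale block_action =
  fixes s b :: "'p \<Rightarrow> 'p" and C :: "nat \<Rightarrow> 'p set" and k d h :: nat
    and z :: "nat \<Rightarrow> nat" and g :: "nat \<Rightarrow> nat \<Rightarrow> nat" and M :: "nat \<Rightarrow> nat set"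
  assumes inj_s: "inj s" and inj_b: "inj b" and comm: "s \<circ> b = b \<circ> s"
    and C_disj: "\<lbrakk>i \<in> {1..k}; j \<in> {1..k}; q \<in> C i; q \<in> C j\<rbrakk> \<Longrightarrow> i = j"
    and C_card: "j \<in> {1..k} \<Longrightarrow> card (C j) = d"
    and C_rotates: "j \<in> {1..k} \<Longrightarrow> rotates s (C j)"
    and M_sub: "t \<in> {1..h} \<Longrightarrow> M t \<subseteq> {1..k}"
    and M_disj: "\<lbrakk>t \<in> {1..h}; t' \<in> {1..h}; j \<in> M t; j \<in> M t'\<rbrakk> \<Longrightarrow> t = t'"
    and M_card: "t \<in> {1..h} \<Longrightarrow> card (M t) \<ge> 2"
    and M_rotates: "t \<in> {1..h} \<Longrightarrow> rotates (g t) (M t)"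
    and b_moved: "\<lbrakk>t \<in> {1..h}; j \<in> M t; q \<in> C j\<rbrakk> \<Longrightarrow> b q \<in> C (g t j)"
    and z_moved: "\<lbrakk>t \<in> {1..h}; j \<in> M t\<rbrakk> \<Longrightarrow> z j mod d = 0"
    and b_unmoved: "\<lbrakk>j \<in> {1..k}; j \<notin> (\<Union>t\<in>{1..h}. M t); q \<in> C j\<rbrakk> \<Longrightarrow> b q = (s ^^ z j) q"
begin

abbreviation moved :: "nat set" where "moved \<equiv> (\<Union>t\<in>{1..h}. M t)"

abbreviation points :: "'p set" where "points \<equiv> (\<Union>j\<in>{1..k}. C j)"

lemma moved_sub: "moved \<subseteq> {1..k}" using M_sub by blast

lemma M_in: "t \<in> {1..h} \<Longrightarrow> j \<in> M t \<Longrightarrow> j \<in> {1..k}" using M_sub by blast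

lemma finite_M: "t \<in> {1..h} \<Longrightarrow> finite (M t)" using M_rotates unfolding rotates_def by blast

lemma finite_C: "j \<in> {1..k} \<Longrightarrow> finite (C j)" using C_rotates unfolding rotates_def by blast

lemma C_nonempty: "j \<in> {1..k} \<Longrightarrow> C j \<noteq> {}" using C_rotates unfolding rotates_def by blast

lemma C_funpow: "j \<in> {1..k} \<Longrightarrow> q \<in> C j \<Longrightarrow> (s ^^ u) q \<in> C j"
  using rotates_funpow_in[OF C_rotates] .

lemma C_period: "j \<in> {1..k} \<Longrightarrow> q \<in> C j \<Longrightarrow> (s ^^ u) q = (s ^^ v) q \<longleftrightarrow> u mod d = v mod d"
  using rotates_funpow_eq[OF C_rotates] C_card by metis

lemma card_moved: "card moved = (\<Sum>t\<in>{1..h}. card (M t))"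
  by (rule card_UN_disjoint) (use finite_M M_disj in \<open>auto\<close>)

lemma b_funpow_moved:
  assumes "t \<in> {1..h}" "j \<in> M t" "q \<in> C j"
  shows "(b ^^ v) q \<in> C ((g t ^^ v) j)"
proof (induction v)
  case (Suc v)
  have "(g t ^^ v) j \<in> M t" using rotates_funpow_in[OF M_rotates] assms by metis
  then show ?case using b_moved[OF assms(1) _ Suc] by simp
qed (use assms in simp)

lemma coincidences_unmoved:
  assumes "j \<in> {1..k}" "j \<notin> moved" "q \<in> C j"
  shows "coincidences s b q = lattice_coincidences d 1 (z j)"
  unfolding lattice_coincidences_def
  by (rule coincidences_eqI[OF inj_s inj_b comm])
    (use C_period b_unmoved assms in auto)

lemma coincidences_moved:
  assumes "t \<in> {1..h}" "j \<in> M t" "q \<in> C j" "(b ^^ card (M t)) q = (s ^^ c) q"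
  shows "coincidences s b q = lattice_coincidences d (card (M t)) c"
  unfolding lattice_coincidences_def
proof (rule coincidences_eqI[OF inj_s inj_b comm])
  have j: "j \<in> {1..k}" using M_sub assms by blast
  show "card (M t) > 0" using M_card[OF assms(1)] by simp
  show "(s ^^ u) q = (s ^^ v) q \<longleftrightarrow> u mod d = v mod d" for u v
    using C_period j assms by blast
  show "(b ^^ card (M t)) q = (s ^^ c) q" by fact
  fix u v u' v' assume eq: "(s ^^ u) ((b ^^ v) q) = (s ^^ u') ((b ^^ v') q)"
  have g: "(g t ^^ w) j \<in> {1..k}" for w
    using rotates_funpow_in[OF M_rotates] assms M_sub by blast
  have "(s ^^ w) ((b ^^ w') q) \<in> C ((g t ^^ w') j)" for w w'
    using C_funpow[OF g b_funpow_moved[OF assms(1-3)]] .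
  then have "(g t ^^ v) j = (g t ^^ v') j" using C_disj[OF g g] eq by metis
  then show "v mod card (M t) = v' mod card (M t)"
    using rotates_funpow_eq[OF M_rotates] assms by blast
qed

lemma card_points_split:
  "card {q \<in> points. R q} = (\<Sum>j\<in>{1..k}. card {q \<in> C j. R q})"
proof -
  have "{q \<in> points. R q} = (\<Union>j\<in>{1..k}. {q \<in> C j. R q})" by auto
  also have "card \<dots> = (\<Sum>j\<in>{1..k}. card {q \<in> C j. R q})"
    by (rule card_UN_disjoint) (use finite_C C_disj in auto)
  finally show ?thesis .
qed

lemma sum_split:
  "(\<Sum>j\<in>{1..k}. F j) = (\<Sum>j\<in>{1..k} - moved. F j) + (\<Sum>t\<in>{1..h}. \<Sum>j\<in>M t. F j)" for F :: "nat \<Rightarrow> nat"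
proof -
  have "(\<Sum>j\<in>{1..k}. F j) = (\<Sum>j\<in>{1..k} - moved. F j) + (\<Sum>j\<in>moved. F j)"
    using moved_sub by (intro sum.subset_diff) auto
  also have "(\<Sum>j\<in>moved. F j) = (\<Sum>t\<in>{1..h}. \<Sum>j\<in>M t. F j)"
    by (rule sum.UNION_disjoint) (use finite_M M_disj in auto)
  finally show ?thesis .
qed

text \<open>
  In the sum over all exponents each moved cycle is counted as if \<open>b\<close> fixed it pointwise; the second
  summand on the left makes up for this. In this form the right-hand side depends only on the list of
  exponents and on the lengths and return exponents of the moved orbits, which are
  the data compared by the conjugacy criterion.
\<close>
lemma card_coincidences:
  assumes c: "\<And>t j q. \<lbrakk>t \<in> {1..h}; j \<in> M t; q \<in> C j\<rbrakk> \<Longrightarrow> (b ^^ card (M t)) q = (s ^^ c t) q"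
  shows "card {q \<in> points. coincidences s b q = T} + d * card moved * of_bool (lattice_coincidences d 1 0 = T)
    = (\<Sum>j\<in>{1..k}. d * of_bool (lattice_coincidences d 1 (z j) = T)) +
      (\<Sum>t\<in>{1..h}. card (M t) * d * of_bool (lattice_coincidences d (card (M t)) (c t) = T))"
proof -
  let ?L = "\<lambda>m c. d * of_bool (lattice_coincidences d m c = T) :: nat"
  have const: "card {q \<in> C j. coincidences s b q = T} = d * of_bool (T' = T)"
    if "j \<in> {1..k}" "\<And>q. q \<in> C j \<Longrightarrow> coincidences s b q = T'" for j T'
  proof -
    have "{q \<in> C j. coincidences s b q = T} = (if T' = T then C j else {})" using that(2) by auto
    then show ?thesis using C_card[OF that(1)] by simp
  qed
  have 1: "card {q \<in> C j. coincidences s b q = T} = ?L 1 (z j)" if "j \<in> {1..k} - moved" for j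
    using that coincidences_unmoved by (intro const) auto
  have 2: "card {q \<in> C j. coincidences s b q = T} = ?L (card (M t)) (c t)"
    if "t \<in> {1..h}" "j \<in> M t" for t j
    using coincidences_moved[OF that _ c[OF that]] M_in[OF that] by (intro const) auto
  have 3: "?L 1 (z j) = ?L 1 0" if "t \<in> {1..h}" "j \<in> M t" for t j
    using lattice_coincidences_mod[of "z j" d 0 1] z_moved[OF that] by simp
  have "card {q \<in> points. coincidences s b q = T} =
      (\<Sum>j\<in>{1..k} - moved. ?L 1 (z j)) + (\<Sum>t\<in>{1..h}. \<Sum>j\<in>M t. ?L (card (M t)) (c t))"
    unfolding card_points_split sum_split using 1 2 by simp
  moreover have "(\<Sum>j\<in>{1..k}. ?L 1 (z j)) =
      (\<Sum>j\<in>{1..k} - moved. ?L 1 (z j)) + (\<Sum>t\<in>{1..h}. \<Sum>j\<in>M t. ?L 1 0)"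
    unfolding sum_split[of "\<lambda>j. ?L 1 (z j)"]
    by (intro arg_cong2[where f = "(+)"] sum.cong refl 3)
  moreover have "(\<Sum>t\<in>{1..h}. \<Sum>j\<in>M t. ?L 1 0) = d * card moved * of_bool (lattice_coincidences d 1 0 = T)"
    unfolding card_moved by (simp add: sum_distrib_right sum_distrib_left mult_ac)
  ultimately show ?thesis by (simp add: mult_ac)
qed

text \<open>
  A cycle of length at least 2 on the indices has no fixed index.
\<close>
lemma b_stays_iff:
  assumes "j \<in> {1..k}" "q \<in> C j"
  shows "b q \<in> C j \<longleftrightarrow> j \<notin> moved"
proof
  assume b: "b q \<in> C j"
  show "j \<notin> moved"
  proof
    assume "j \<in> moved"
    then obtain t where t: "t \<in> {1..h}" "j \<in> M t" by auto
    have "g t j \<in> M t" using rotates_funpow_in[OF M_rotates, of t j 1] t by simp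
    then have "g t j = j" using C_disj[OF _ assms(1) b_moved[OF t assms(2)] b] M_sub t by blast
    moreover have "1 mod card (M t) = 1" using M_card[OF t(1)] by simp
    ultimately show False using rotates_funpow_eq[OF M_rotates t(2), of 1 0] t by simp
  qed
next
  assume "j \<notin> moved"
  then show "b q \<in> C j" using b_unmoved assms C_funpow by simp
qed

text \<open>
  Exactly the unmoved cycles with exponent 0 modulo \<open>d\<close> are fixed pointwise. Given the exponents,
  more moved cycles mean fewer fixed points.
\<close>
lemma card_fixed_points:
  "card {q \<in> points. b q = q} + d * card moved = d * card {j \<in> {1..k}. z j mod d = 0}"
proof -
  have 1: "card {q \<in> C j. b q = q} = d * of_bool (z j mod d = 0)" if "j \<in> {1..k} - moved" for j
  proof -
    have "b q = q \<longleftrightarrow> z j mod d = 0" if "q \<in> C j" for q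
      using C_period[of j q "z j" 0] b_unmoved \<open>j \<in> {1..k} - moved\<close> that by auto
    then have "{q \<in> C j. b q = q} = (if z j mod d = 0 then C j else {})" by auto
    then show ?thesis using C_card that by simp
  qed
  have 2: "card {q \<in> C j. b q = q} = 0" if "t \<in> {1..h}" "j \<in> M t" for t j
  proof -
    have "j \<in> {1..k}" "j \<in> moved" using that M_in[OF that] by auto
    then have "{q \<in> C j. b q = q} = {}" using b_stays_iff by force
    then show ?thesis by (simp only: card.empty)
  qed
  have "d * card {j \<in> {1..k}. z j mod d = 0} = (\<Sum>j\<in>{1..k}. d * of_bool (z j mod d = 0))"
    by (simp add: sum_distrib_left[symmetric] Int_def)
  also have "\<dots> = (\<Sum>j\<in>{1..k} - moved. d * of_bool (z j mod d = 0)) + (\<Sum>t\<in>{1..h}. \<Sum>j\<in>M t. d)"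
    unfolding sum_split using z_moved by simp
  also have "\<dots> = card {q \<in> points. b q = q} + d * card moved"
    unfolding card_points_split sum_split card_moved using 1 2
    by (simp add: sum_distrib_left mult_ac)
  finally show ?thesis by simp
qed

text \<open>
  Both powers commute with \<open>s\<close> and \<open>b\<close>, which together act transitively on the
  points of the cycles with index in \<open>M t\<close>.
\<close>
lemma orbit_return_uniform:
  assumes "t \<in> {1..h}" "j \<in> M t" "q \<in> C j" "(b ^^ m) q = (s ^^ c) q" "j' \<in> M t" "q' \<in> C j'"
  shows "(b ^^ m) q' = (s ^^ c) q'"
proof -
  obtain v where v: "j' = (g t ^^ v) j" using rotates_reach[OF M_rotates] assms by metis
  have "(b ^^ v) q \<in> C j'" unfolding v by (rule b_funpow_moved[OF assms(1-3)])
  moreover have "j' \<in> {1..k}" using assms M_sub by blast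
  ultimately obtain u where u: "q' = (s ^^ u) ((b ^^ v) q)"
    using rotates_reach[OF C_rotates] assms by metis
  note cm = funpow_comm[OF comm]
  have bb: "(b ^^ m) ((b ^^ v) p) = (b ^^ v) ((b ^^ m) p)"
    and ss: "(s ^^ u) ((s ^^ c) p) = (s ^^ c) ((s ^^ u) p)" for p
    by (metis add.commute comp_apply funpow_add)+
  show ?thesis unfolding u by (simp only: cm[symmetric] bb assms(4)) (simp only: cm ss)
qed

lemma return_exists:
  assumes "t \<in> {1..h}"
  shows "\<exists>c. \<forall>j\<in>M t. \<forall>q\<in>C j. (b ^^ card (M t)) q = (s ^^ c) q"
proof -
  obtain j where j: "j \<in> M t" using M_card[OF assms] by fastforce
  then have jk: "j \<in> {1..k}" using M_sub assms by blast
  obtain q where q: "q \<in> C j" using C_nonempty[OF jk] by blast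
  have "(g t ^^ card (M t)) j = (g t ^^ 0) j"
    unfolding rotates_funpow_eq[OF M_rotates[OF assms] j] by simp
  then have "(b ^^ card (M t)) q \<in> C j"
    using b_funpow_moved[OF assms j q, of "card (M t)"] by simp
  then obtain c where "(b ^^ card (M t)) q = (s ^^ c) q"
    using rotates_reach[OF C_rotates[OF jk] q] by blast
  then show ?thesis using orbit_return_uniform[OF assms j q] by blast
qed

end

section \<open>Comparing two actions on the same cycles\<close>

locale block_pair =
  P: block_action s b C k d h z g M + Q: block_action s b' C k d h' z' g' M'
  for s b :: "'p \<Rightarrow> 'p" and C :: "nat \<Rightarrow> 'p set" and k d h z g M b' h' z' g' M'
begin

text \<open>
  A factor missed by \<open>f\<close> would move some cycle, so it cannot exist if equally many cycles are moved in total.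
\<close>
lemma card_moved_le:
  assumes "f ` {1..h} \<subseteq> {1..h'}" "inj_on f {1..h}"
    and "\<And>t. t \<in> {1..h} \<Longrightarrow> card (M' (f t)) = card (M t)"
  shows "card P.moved \<le> card Q.moved"
    and "card P.moved = card Q.moved \<Longrightarrow> f ` {1..h} = {1..h'}"
proof -
  have eq: "card P.moved = (\<Sum>t\<in>f ` {1..h}. card (M' t))"
    unfolding P.card_moved sum.reindex[OF assms(2)] using assms(3) by simp
  have split: "card Q.moved = (\<Sum>t\<in>{1..h'} - f ` {1..h}. card (M' t)) + (\<Sum>t\<in>f ` {1..h}. card (M' t))"
    unfolding Q.card_moved using assms(1) by (intro sum.subset_diff) auto
  show "card P.moved \<le> card Q.moved" using eq split by simp
  assume "card P.moved = card Q.moved"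
  then have "(\<Sum>t\<in>{1..h'} - f ` {1..h}. card (M' t)) = 0" using eq split by simp
  then have "card (M' t) = 0" if "t \<in> {1..h'} - f ` {1..h}" for t using that by simp
  then show "f ` {1..h} = {1..h'}" using Q.M_card assms(1) by fastforce
qed

text \<open>
  All other terms of the formula \<open>card_coincidences\<close> for the two actions correspond under \<open>r\<close> and \<open>f\<close>.
\<close>
lemma card_coincidences_eq:
  assumes r: "r permutes {1..k}" "\<And>j. j \<in> {1..k} \<Longrightarrow> z j mod d = z' (r j) mod d"
    and f: "bij_betw f {1..h} {1..h'}" "\<And>t. t \<in> {1..h} \<Longrightarrow> card (M' (f t)) = card (M t)"
    and return: "\<And>t. t \<in> {1..h} \<Longrightarrow> \<exists>c. (\<forall>j\<in>M t. \<forall>q\<in>C j. (b ^^ card (M t)) q = (s ^^ c) q) \<and>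
      (\<forall>j\<in>M' (f t). \<forall>q\<in>C j. (b' ^^ card (M t)) q = (s ^^ c) q)"
  shows "card {q \<in> P.points. coincidences s b q = T} = card {q \<in> P.points. coincidences s b' q = T}"
proof -
  let ?L = "\<lambda>m c. of_bool (lattice_coincidences d m c = T) :: nat"
  obtain c where c: "\<And>t. t \<in> {1..h} \<Longrightarrow> (\<forall>j\<in>M t. \<forall>q\<in>C j. (b ^^ card (M t)) q = (s ^^ c t) q) \<and>
      (\<forall>j\<in>M' (f t). \<forall>q\<in>C j. (b' ^^ card (M t)) q = (s ^^ c t) q)"
    using return by metis
  define c' where "c' t' = c (inv_into {1..h} f t')" for t'
  have c': "(b' ^^ card (M' t')) q = (s ^^ c' t') q" if "t' \<in> {1..h'}" "j \<in> M' t'" "q \<in> C j" for t' j q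
  proof -
    define t where "t = inv_into {1..h} f t'"
    have t: "t \<in> {1..h}" "f t = t'"
      using inv_into_into[of t' f "{1..h}"] f_inv_into_f[of t' f "{1..h}"] f(1) that(1)
      unfolding t_def bij_betw_def by simp_all
    show ?thesis using c[OF t(1)] f(2)[OF t(1)] that(2,3) t by (simp add: c'_def t_def)
  qed
  have inv: "c' (f t) = c t" if "t \<in> {1..h}" for t
    using that f(1) unfolding c'_def bij_betw_def by (simp add: inv_into_f_f)
  have "(\<Sum>j\<in>{1..k}. d * ?L 1 (z j)) = (\<Sum>j\<in>{1..k}. d * ?L 1 (z' (r j)))"
    using lattice_coincidences_mod[OF r(2)] by simp
  also have "\<dots> = (\<Sum>j\<in>{1..k}. d * ?L 1 (z' j))"
    by (rule sum.permute[OF r(1), of "\<lambda>j. d * ?L 1 (z' j)", unfolded comp_def, symmetric])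
  finally have 1: "(\<Sum>j\<in>{1..k}. d * ?L 1 (z j)) = (\<Sum>j\<in>{1..k}. d * ?L 1 (z' j))" .
  have 2: "(\<Sum>t\<in>{1..h'}. card (M' t) * d * ?L (card (M' t)) (c' t)) =
      (\<Sum>t\<in>{1..h}. card (M t) * d * ?L (card (M t)) (c t))"
    unfolding sum.reindex_bij_betw[OF f(1), symmetric] using f(2) inv by simp
  have moved: "card P.moved = card Q.moved"
    unfolding P.card_moved Q.card_moved sum.reindex_bij_betw[OF f(1), symmetric] using f(2) by simp
  have "(b ^^ card (M t)) q = (s ^^ c t) q" if "t \<in> {1..h}" "j \<in> M t" "q \<in> C j" for t j q
    using c that by blast
  from P.card_coincidences[of c T, OF this] Q.card_coincidences[of c' T, OF c']
  have "card {q \<in> P.points. coincidences s b q = T} + d * card Q.moved * ?L 1 0 =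
      card {q \<in> P.points. coincidences s b' q = T} + d * card Q.moved * ?L 1 0"
    by (simp only: 1 2 moved)
  then show ?thesis by (simp only: add_right_cancel)
qed

text \<open>
  The cycles \<open>C j\<close> are orbits of \<open>s\<close>, and a map commuting with \<open>s\<close> carries orbits to orbits.
\<close>
lemma equivariant_permutation:
  assumes w: "inj w" "\<And>q. w (s q) = s (w q)" "w ` P.points \<subseteq> P.points"
  obtains r where "r permutes {1..k}" "\<And>j q. j \<in> {1..k} \<Longrightarrow> q \<in> C j \<Longrightarrow> w q \<in> C (r j)"
proof -
  have ws: "w ((s ^^ u) q) = (s ^^ u) (w q)" for u q by (induction u) (simp_all add: w(2))
  have ex: "\<exists>i\<in>{1..k}. \<forall>q\<in>C j. w q \<in> C i" if j: "j \<in> {1..k}" for j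
  proof -
    obtain q where q: "q \<in> C j" using P.C_nonempty[OF j] by blast
    then have "w q \<in> P.points" using w(3) j by blast
    then obtain i where i: "i \<in> {1..k}" "w q \<in> C i" by blast
    have "w q' \<in> C i" if "q' \<in> C j" for q'
      using rotates_reach[OF P.C_rotates[OF j] q that] P.C_funpow[OF i] ws by metis
    then show ?thesis using i(1) by blast
  qed
  then obtain r0 where r0: "\<And>j. j \<in> {1..k} \<Longrightarrow> r0 j \<in> {1..k} \<and> (\<forall>q\<in>C j. w q \<in> C (r0 j))"
    by metis
  have onto: "w ` C j = C (r0 j)" if j: "j \<in> {1..k}" for j
  proof (rule card_subset_eq)
    show "finite (C (r0 j))" using P.finite_C r0[OF j] by blast
    show "w ` C j \<subseteq> C (r0 j)" using r0[OF j] by blast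
    show "card (w ` C j) = card (C (r0 j))"
      using card_image[OF inj_on_subset[OF w(1) subset_UNIV]] P.C_card r0[OF j] j by metis
  qed
  have "inj_on r0 {1..k}"
  proof (rule inj_onI)
    fix i j assume ij: "i \<in> {1..k}" "j \<in> {1..k}" "r0 i = r0 j"
    then have "C i = C j" using onto w(1) by (metis inj_image_eq_iff)
    then show "i = j" using P.C_disj[OF ij(1,2)] P.C_nonempty[OF ij(1)] by blast
  qed
  then have "bij_betw r0 {1..k} {1..k}"
    using r0 by (intro bij_betw_imageI endo_inj_surj) auto
  define r where "r j = (if j \<in> {1..k} then r0 j else j)" for j
  have "bij_betw r {1..k} {1..k}"
    using \<open>bij_betw r0 {1..k} {1..k}\<close> bij_betw_cong[of "{1..k}" r r0] by (simp add: r_def)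
  then have "r permutes {1..k}" by (rule bij_imp_permutes) (simp only: r_def if_False)
  then show ?thesis using that[of r] r0 by (simp add: r_def)
qed

context
  fixes w r
  assumes w: "inj w" "\<And>q. w (s q) = s (w q)" "\<And>q. w (b q) = b' (w q)"
    and r: "r permutes {1..k}" and wr: "\<And>j q. j \<in> {1..k} \<Longrightarrow> q \<in> C j \<Longrightarrow> w q \<in> C (r j)"
begin

lemma r_in: "j \<in> {1..k} \<Longrightarrow> r j \<in> {1..k}" using permutes_in_image[OF r] by blast

lemma w_funpow: "w ((s ^^ u) q) = (s ^^ u) (w q)" "w ((b ^^ u) q) = (b' ^^ u) (w q)"
  by (induction u) (simp_all add: w)

lemma w_onto:
  assumes "j \<in> {1..k}" "q' \<in> C (r j)"
  obtains q where "q \<in> C j" "q' = w q"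
proof -
  obtain q where q: "q \<in> C j" using P.C_nonempty assms(1) by blast
  obtain u where "q' = (s ^^ u) (w q)"
    using rotates_reach[OF P.C_rotates[OF r_in] wr] assms q by metis
  then have "q' = w ((s ^^ u) q)" by (simp add: w_funpow)
  then show ?thesis using that P.C_funpow assms(1) q by blast
qed

text \<open>
  A cycle is moved if and only if \<open>b\<close> takes its points off it, and \<open>w\<close> transports this property.
\<close>
lemma moved_iff:
  assumes j: "j \<in> {1..k}"
  shows "j \<in> P.moved \<longleftrightarrow> r j \<in> Q.moved"
proof -
  obtain q where q: "q \<in> C j" using P.C_nonempty[OF j] by blast
  have "b q \<in> C j \<longleftrightarrow> b' (w q) \<in> C (r j)"
    unfolding w(3)[symmetric] using w_onto[OF j, of "w (b q)"] wr[OF j] w(1) by (metis injD)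
  then show ?thesis
    using P.b_stays_iff[OF j q] Q.b_stays_iff[OF r_in[OF j] wr[OF j q]] by blast
qed

text \<open>
  On unmoved cycles the exponent can be read off from \<open>b\<close> at one point; on moved cycles both exponents vanish modulo \<open>d\<close>.
\<close>
lemma exponents_eq:
  assumes j: "j \<in> {1..k}"
  shows "z j mod d = z' (r j) mod d"
proof (cases "j \<in> P.moved")
  case True
  then have "r j \<in> Q.moved" using moved_iff[OF j] by blast
  then show ?thesis using True P.z_moved Q.z_moved by fastforce
next
  case False
  then have r': "r j \<notin> Q.moved" using moved_iff[OF j] by blast
  obtain q where q: "q \<in> C j" using P.C_nonempty[OF j] by blast
  have "(s ^^ z j) (w q) = w (b q)" using P.b_unmoved[OF j False q] w_funpow by simp
  also have "\<dots> = (s ^^ z' (r j)) (w q)" using Q.b_unmoved[OF r_in[OF j] r' wr[OF j q]] w(3) by simp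
  finally show ?thesis using P.C_period[OF r_in[OF j] wr[OF j q]] by blast
qed

text \<open>
  As \<open>w\<close> intertwines \<open>b\<close> and \<open>b'\<close>, the permutation \<open>r\<close> intertwines \<open>g t\<close> and \<open>g' t'\<close>, so the cycle of
  \<open>g t\<close> through \<open>j\<close> goes to the cycle of \<open>g' t'\<close> through \<open>r j\<close>.
\<close>
lemma moved_image:
  assumes t: "t \<in> {1..h}" and t': "t' \<in> {1..h'}" and j: "j \<in> M t" "r j \<in> M' t'"
  shows "r ` M t = M' t'"
proof -
  have step: "r (g t i) = g' t' (r i)" if i: "i \<in> M t" "r i \<in> M' t'" for i
  proof -
    have i': "i \<in> {1..k}" "g t i \<in> M t"
      using P.M_in[OF t i(1)] rotates_funpow_in[OF P.M_rotates[OF t] i(1), of 1] by auto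
    obtain q where q: "q \<in> C i" using P.C_nonempty[OF i'(1)] by blast
    have "w (b q) \<in> C (r (g t i))" using wr[OF P.M_in[OF t i'(2)]] P.b_moved[OF t i(1) q] by blast
    moreover have "w (b q) \<in> C (g' t' (r i))"
      using Q.b_moved[OF t' i(2)] wr[OF i'(1) q] w(3) by simp
    moreover have "g' t' (r i) \<in> {1..k}"
      using Q.M_in[OF t'] rotates_funpow_in[OF Q.M_rotates[OF t'] i(2), of 1] by simp
    moreover have "r (g t i) \<in> {1..k}" using r_in P.M_in[OF t i'(2)] by blast
    ultimately show ?thesis using P.C_disj by blast
  qed
  have iter: "r ((g t ^^ v) j) = (g' t' ^^ v) (r j)" for v
  proof (induction v)
    case (Suc v)
    have "(g t ^^ v) j \<in> M t" using rotates_funpow_in[OF P.M_rotates[OF t] j(1)] .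
    moreover have "r ((g t ^^ v) j) \<in> M' t'"
      unfolding Suc using rotates_funpow_in[OF Q.M_rotates[OF t'] j(2)] .
    ultimately show ?case using step Suc by simp
  qed simp
  show ?thesis
  proof
    show "r ` M t \<subseteq> M' t'"
    proof
      fix i assume "i \<in> r ` M t"
      then obtain v where "i = r ((g t ^^ v) j)" using rotates_reach[OF P.M_rotates[OF t] j(1)] by blast
      then show "i \<in> M' t'" unfolding iter using rotates_funpow_in[OF Q.M_rotates[OF t'] j(2)] by simp
    qed
    show "M' t' \<subseteq> r ` M t"
    proof
      fix i assume "i \<in> M' t'"
      then obtain v where "i = r ((g t ^^ v) j)"
        using rotates_reach[OF Q.M_rotates[OF t'] j(2)] iter by metis
      then show "i \<in> r ` M t" using rotates_funpow_in[OF P.M_rotates[OF t] j(1)] by simp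
    qed
  qed
qed

lemma moved_matching:
  obtains f where "f ` {1..h} \<subseteq> {1..h'}" "inj_on f {1..h}" "\<And>t. t \<in> {1..h} \<Longrightarrow> r ` M t = M' (f t)"
proof -
  have "\<exists>t'\<in>{1..h'}. r ` M t = M' t'" if t: "t \<in> {1..h}" for t
  proof -
    obtain j where j: "j \<in> M t" using P.M_card[OF t] by fastforce
    then have "r j \<in> Q.moved" using moved_iff[OF P.M_in[OF t j]] t by blast
    then obtain t' where "t' \<in> {1..h'}" "r j \<in> M' t'" by blast
    then show ?thesis using moved_image[OF t _ j] by blast
  qed
  then obtain f where f: "\<And>t. t \<in> {1..h} \<Longrightarrow> f t \<in> {1..h'} \<and> r ` M t = M' (f t)" by metis
  have "inj_on f {1..h}"
  proof (rule inj_onI)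
    fix t t' assume t: "t \<in> {1..h}" "t' \<in> {1..h}" "f t = f t'"
    then have "r ` M t = r ` M t'" using f by metis
    then have "M t = M t'" using permutes_inj[OF r] by (simp add: inj_image_eq_iff)
    then show "t = t'" using P.M_disj[OF t(1,2)] P.M_card[OF t(1)] by fastforce
  qed
  then show ?thesis using that[of f] f by blast
qed

lemma return_transfer:
  assumes "t \<in> {1..h}" "r ` M t = M' t'"
    and "\<forall>j\<in>M t. \<forall>q\<in>C j. (b ^^ m) q = (s ^^ c) q"
  shows "\<forall>j\<in>M' t'. \<forall>q\<in>C j. (b' ^^ m) q = (s ^^ c) q"
proof (intro ballI)
  fix j' q' assume "j' \<in> M' t'" and q': "q' \<in> C j'"
  then have "j' \<in> r ` M t" by (simp only: assms(2))
  then obtain j where j: "j \<in> M t" "q' \<in> C (r j)" using q' by blast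
  obtain q where "q \<in> C j" "q' = w q" using w_onto[OF P.M_in[OF assms(1) j(1)] j(2)] .
  then show "(b' ^^ m) q' = (s ^^ c) q'" 
    using assms(3) j(1) by (simp only: w_funpow(2)[symmetric] w_funpow(1)[symmetric])
qed

end

end

section \<open>Products of disjoint permutations in the symmetric group\<close>

lemma movpts_permutes: "p permutes {1..n} \<Longrightarrow> movpts n p = {q. p q \<noteq> q}"
  unfolding movpts_def fixpts_def using permutes_not_in by fastforce

lemma disjoint_perms_iff:
  assumes "p permutes {1..n}" "p' permutes {1..n}"
  shows "disjoint_perms n p p' \<longleftrightarrow> (\<forall>q. p q = q \<or> p' q = q)"
  unfolding disjoint_perms_def movpts_permutes[OF assms(1)] movpts_permutes[OF assms(2)] by blast

lemma gprod_sym_fixed: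
  "(\<And>j. j \<in> {1..k} \<Longrightarrow> f j q = q) \<Longrightarrow> gprod (sym_group n) f k q = q"
proof (induction k)
  case (Suc k)
  have "gprod (sym_group n) f k q = q" by (rule Suc.IH) (use Suc.prems in simp)
  then show ?case using Suc.prems[of "Suc k"] by (simp add: sym_group_mult)
qed (simp add: sym_group_one)

text \<open>
  The factors other than \<open>f j\<close> fix both \<open>q\<close> and \<open>f j q\<close>, since \<open>f j\<close> moves these points.
\<close>
lemma gprod_sym_moved:
  assumes "\<And>j. j \<in> {1..k} \<Longrightarrow> f j permutes {1..n}"
    and "\<And>j j'. \<lbrakk>j \<in> {1..k}; j' \<in> {1..k}; j \<noteq> j'\<rbrakk> \<Longrightarrow> disjoint_perms n (f j) (f j')"
    and "j \<in> {1..k}" "f j q \<noteq> q"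
  shows "gprod (sym_group n) f k q = f j q"
  using assms
proof (induction k)
  case (Suc k)
  have disj: "f i p = p \<or> f i' p = p" if "i \<in> {1..Suc k}" "i' \<in> {1..Suc k}" "i \<noteq> i'" for i i' p
    using Suc.prems(2)[OF that] disjoint_perms_iff[OF Suc.prems(1)[OF that(1)] Suc.prems(1)[OF that(2)]]
    by blast
  show ?case
  proof (cases "j = Suc k")
    case True
    have "f j (f j q) \<noteq> f j q"
      using permutes_inj[OF Suc.prems(1)[OF Suc.prems(3)]] Suc.prems(4) by (metis injD)
    then have "f i (f j q) = f j q" if "i \<in> {1..k}" for i
      using disj[of i j "f j q"] Suc.prems(3) True that by auto
    then show ?thesis using gprod_sym_fixed[of k f "f j q" n] True by (simp add: sym_group_mult)
  next
    case False
    then have j: "j \<in> {1..k}" using Suc.prems(3) by auto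
    have "f (Suc k) q = q" using disj[OF Suc.prems(3), of "Suc k" q] False Suc.prems(4) by auto
    moreover have "gprod (sym_group n) f k q = f j q"
      by (rule Suc.IH[OF _ _ j Suc.prems(4)]) (use Suc.prems(1,2) in auto)
    ultimately show ?thesis by (simp add: sym_group_mult)
  qed
qed simp

lemma gprod_sym_permutes:
  "(\<And>j. j \<in> {1..k} \<Longrightarrow> f j permutes {1..n}) \<Longrightarrow> gprod (sym_group n) f k permutes {1..n}"
proof (induction k)
  case (Suc k)
  have "gprod (sym_group n) f k permutes {1..n}" by (rule Suc.IH) (use Suc.prems in simp)
  moreover have "f (Suc k) permutes {1..n}" using Suc.prems by simp
  ultimately show ?case unfolding gprod.simps sym_group_mult by (intro permutes_compose)
qed (simp add: sym_group_one permutes_id)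

lemma sym_group_nat_pow: "p [^]\<^bsub>sym_group n\<^esub> (m::nat) = p ^^ m"
proof (induction m)
  case (Suc m)
  interpret group "sym_group n" by (rule sym_group_is_group)
  show ?case by (simp only: nat_pow_Suc Suc sym_group_mult funpow_Suc_right)
next
  case 0
  interpret group "sym_group n" by (rule sym_group_is_group)
  show ?case by (simp add: sym_group_one)
qed

text \<open>
  Reducing the exponent modulo the order turns a power with integer exponent into an iterated function.
\<close>
lemma sym_group_int_pow:
  assumes p: "p permutes {1..n}" and "p ^^ d = id" "d > 0"
  shows "p [^]\<^bsub>sym_group n\<^esub> (c::int) = p ^^ nat (c mod int d)"
proof -
  interpret group "sym_group n" by (rule sym_group_is_group)
  have pc: "p \<in> carrier (sym_group n)" using p by (simp add: sym_group_carrier)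
  have "p [^]\<^bsub>sym_group n\<^esub> c = p [^]\<^bsub>sym_group n\<^esub> (int d * (c div int d) + c mod int d)" by simp
  also have "\<dots> = p [^]\<^bsub>sym_group n\<^esub> (int d * (c div int d)) \<otimes>\<^bsub>sym_group n\<^esub> p [^]\<^bsub>sym_group n\<^esub> (c mod int d)"
    by (rule int_pow_mult[OF pc])
  also have "p [^]\<^bsub>sym_group n\<^esub> (int d * (c div int d)) = \<one>\<^bsub>sym_group n\<^esub>"
  proof -
    have "p [^]\<^bsub>sym_group n\<^esub> int d = \<one>\<^bsub>sym_group n\<^esub>"
      unfolding int_pow_int sym_group_nat_pow assms(2) by (simp add: sym_group_one)
    then show ?thesis using int_pow_pow[OF pc, of "int d" "c div int d"] by (simp add: int_pow_one)
  qed
  also have "\<one>\<^bsub>sym_group n\<^esub> \<otimes>\<^bsub>sym_group n\<^esub> p [^]\<^bsub>sym_group n\<^esub> (c mod int d) = p [^]\<^bsub>sym_group n\<^esub> (c mod int d)"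
    using pc by simp
  also have "\<dots> = p [^]\<^bsub>sym_group n\<^esub> int (nat (c mod int d))" using assms(3) by simp
  also have "\<dots> = p ^^ nat (c mod int d)" unfolding int_pow_int sym_group_nat_pow ..
  finally show ?thesis .
qed

locale cycle_family =
  fixes n k d :: nat and T :: "nat \<Rightarrow> nat \<Rightarrow> nat"
  assumes T_perm: "j \<in> {1..k} \<Longrightarrow> T j permutes {1..n}"
    and T_cycle: "j \<in> {1..k} \<Longrightarrow> is_cycle d (T j)"
    and T_disj: "\<lbrakk>i \<in> {1..k}; j \<in> {1..k}; i \<noteq> j\<rbrakk> \<Longrightarrow> disjoint_perms n (T i) (T j)"
begin

abbreviation C :: "nat \<Rightarrow> nat set" where "C j \<equiv> movpts n (T j)"

abbreviation S :: "nat \<Rightarrow> nat" where "S \<equiv> gprod (sym_group n) T k"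

abbreviation points :: "nat set" where "points \<equiv> (\<Union>j\<in>{1..k}. C j)"

lemma C_eq: "j \<in> {1..k} \<Longrightarrow> C j = {q. T j q \<noteq> q}" using movpts_permutes[OF T_perm] .

lemma T_rotates: "j \<in> {1..k} \<Longrightarrow> rotates (T j) (C j)"
  and card_C: "j \<in> {1..k} \<Longrightarrow> card (C j) = d"
  using is_cycle_rotates[OF T_cycle] C_eq by simp_all

lemma C_disjoint: "\<lbrakk>i \<in> {1..k}; j \<in> {1..k}; q \<in> C i; q \<in> C j\<rbrakk> \<Longrightarrow> i = j"
  using T_disj unfolding disjoint_perms_def by blast

lemma C_nonempty: "j \<in> {1..k} \<Longrightarrow> \<exists>q. q \<in> C j"
  using T_rotates unfolding rotates_def by blast

lemma d_pos: "j \<in> {1..k} \<Longrightarrow> d > 0"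
  using is_cycle_rotates(3)[OF T_cycle, of j] by simp

lemma S_on: "j \<in> {1..k} \<Longrightarrow> q \<in> C j \<Longrightarrow> S q = T j q"
  by (rule gprod_sym_moved[OF T_perm T_disj]) (auto simp: C_eq)

lemma S_rotates: "j \<in> {1..k} \<Longrightarrow> rotates S (C j)"
  by (rule rotates_cong[OF T_rotates S_on])

lemma S_off: "q \<notin> points \<Longrightarrow> S q = q"
  by (rule gprod_sym_fixed) (use C_eq in blast)

lemma S_permutes: "S permutes {1..n}"
  by (rule gprod_sym_permutes[OF T_perm])

lemma movpts_S: "movpts n S = points"
proof -
  have "S q \<noteq> q \<longleftrightarrow> q \<in> points" for q
    using S_off[of q] S_on C_eq by fastforce
  then show ?thesis using movpts_permutes[OF S_permutes] by blast
qed

lemma T_funpow_d: "j \<in> {1..k} \<Longrightarrow> T j ^^ d = id"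
proof
  fix q assume j: "j \<in> {1..k}"
  show "(T j ^^ d) q = id q"
  proof (cases "q \<in> C j")
    case True
    then show ?thesis using rotates_funpow_eq[OF T_rotates[OF j] True, of d 0] card_C[OF j] by simp
  next
    case False
    then have "T j q = q" using C_eq[OF j] by blast
    then have "(T j ^^ u) q = q" for u by (induction u) simp_all
    then show ?thesis by simp
  qed
qed

lemma T_int_pow: "j \<in> {1..k} \<Longrightarrow> T j [^]\<^bsub>sym_group n\<^esub> (c::int) = T j ^^ nat (c mod int d)"
  by (rule sym_group_int_pow[OF T_perm T_funpow_d d_pos])

lemma T_funpow_fixed: "j \<in> {1..k} \<Longrightarrow> q \<notin> C j \<Longrightarrow> (T j ^^ u) q = q"
  by (induction u) (use C_eq in auto)

text \<open>
  The powers have disjoint supports, so only the factor belonging to \<open>C j\<close> acts on \<open>q\<close>; it is expressed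
  through \<open>S\<close>, which agrees with \<open>T j\<close> there and does not depend on the cycle.
\<close>
lemma gprod_powers_on:
  assumes "j \<in> {1..k}" "q \<in> C j"
  shows "gprod (sym_group n) (\<lambda>i. T i [^]\<^bsub>sym_group n\<^esub> (c i::int)) k q = (S ^^ nat (c j mod int d)) q"
proof -
  let ?f = "\<lambda>i. T i [^]\<^bsub>sym_group n\<^esub> (c i::int)"
  have perm: "?f i permutes {1..n}" if "i \<in> {1..k}" for i
    unfolding T_int_pow[OF that] by (rule permutes_funpow[OF T_perm[OF that]])
  have fixed: "?f i p = p" if "i \<in> {1..k}" "p \<notin> C i" for i p
    unfolding T_int_pow[OF that(1)] by (rule T_funpow_fixed[OF that])
  have disj: "disjoint_perms n (?f i) (?f i')" if "i \<in> {1..k}" "i' \<in> {1..k}" "i \<noteq> i'" for i i'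
    using disjoint_perms_iff[OF perm[OF that(1)] perm[OF that(2)]] fixed that C_disjoint by blast
  have "gprod (sym_group n) ?f k q = ?f j q"
  proof (cases "?f j q = q")
    case True
    then have "?f i q = q" if "i \<in> {1..k}" for i
      using fixed[OF that] C_disjoint[OF that assms(1) _ assms(2)] by blast
    then have "gprod (sym_group n) ?f k q = q" by (rule gprod_sym_fixed)
    then show ?thesis using True by simp
  next
    case False
    with perm disj assms(1) show ?thesis by (rule gprod_sym_moved)
  qed
  moreover have "(T j ^^ u) q = (S ^^ u) q" for u
  proof (induction u)
    case (Suc u)
    then show ?case using S_on[OF assms(1) rotates_funpow_in[OF S_rotates[OF assms(1)] assms(2)], of u] by simp
  qed simp
  ultimately show ?thesis using T_int_pow[OF assms(1)] by simp
qed

lemma gprod_powers_off: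
  assumes "q \<notin> points"
  shows "gprod (sym_group n) (\<lambda>i. T i [^]\<^bsub>sym_group n\<^esub> (c i::int)) k q = q"
proof (rule gprod_sym_fixed)
  fix j assume "j \<in> {1..k}"
  then show "(T j [^]\<^bsub>sym_group n\<^esub> (c j::int)) q = q"
    using T_int_pow T_funpow_fixed assms by simp
qed

lemma cent0_image:
  assumes x: "x \<in> cent0 n S" and j: "j \<in> {1..k}" and i: "i \<in> {1..k}" and q: "q \<in> C j" "x q \<in> C i"
  shows "x ` C j = C i"
proof -
  have xS: "x (S p) = S (x p)" for p using x unfolding cent0_def by (auto simp: fun_eq_iff)
  have "x ((S ^^ u) q) = (S ^^ u) (x q)" for u by (induction u) (simp_all add: xS)
  then have "x ` C j \<subseteq> C i"
    using rotates_reach[OF S_rotates[OF j] q(1)] rotates_funpow_in[OF S_rotates[OF i] q(2)] by force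
  moreover have "inj x" using x permutes_inj unfolding cent0_def by blast
  then have "card (x ` C j) = card (C i)"
    using card_image[OF inj_on_subset[OF _ subset_UNIV]] card_C i j by metis
  moreover have "finite (C i)" using T_rotates[OF i] unfolding rotates_def by blast
  ultimately show ?thesis by (simp add: card_subset_eq)
qed

text \<open>
  Conjugation by \<open>x\<close> turns \<open>T j\<close> into the cycle supported on \<open>x ` C j\<close>. The cycles have disjoint supports,
  so a single point of \<open>C j\<close> decides which cycle that is, and the definite description in
  \<open>cent_image\<close> has a unique solution.
\<close>
lemma cent_image_eqI:
  assumes x: "x \<in> cent0 n S" and j: "j \<in> {1..k}" and i: "i \<in> {1..k}" and q: "q \<in> C j" "x q \<in> C i"
  shows "cent_image n k T x j = i"
proof -
  have xp: "x permutes points" using x unfolding cent0_def movpts_S by blast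
  then have xn: "x permutes {1..n}" by (rule permutes_subset) (auto simp: movpts_def)
  note xi = permutes_inj[OF xp]
  have xS: "x (S p) = S (x p)" for p using x unfolding cent0_def by (auto simp: fun_eq_iff)
  have im: "x ` C j = C i" by (rule cent0_image[OF assms])
  have inv: "inv\<^bsub>sym_group n\<^esub> x = inv' x"
    using xn by (simp add: sym_group_inv_equality sym_group_carrier)
  have conj: "x \<otimes>\<^bsub>sym_group n\<^esub> T j \<otimes>\<^bsub>sym_group n\<^esub> inv\<^bsub>sym_group n\<^esub> x = T s \<longleftrightarrow> x \<circ> T j = T s \<circ> x" for s
  proof
    assume "x \<otimes>\<^bsub>sym_group n\<^esub> T j \<otimes>\<^bsub>sym_group n\<^esub> inv\<^bsub>sym_group n\<^esub> x = T s"
    then show "x \<circ> T j = T s \<circ> x"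
      unfolding sym_group_mult inv using permutes_inv_o(2)[OF xn] by (metis comp_assoc comp_id)
  next
    assume "x \<circ> T j = T s \<circ> x"
    then show "x \<otimes>\<^bsub>sym_group n\<^esub> T j \<otimes>\<^bsub>sym_group n\<^esub> inv\<^bsub>sym_group n\<^esub> x = T s"
      unfolding sym_group_mult inv using permutes_inv_o(1)[OF xn] by (metis comp_assoc comp_id)
  qed
  have "x (T j p) = T i (x p)" for p
  proof (cases "p \<in> C j")
    case True
    then have "x p \<in> C i" using im by blast
    then show ?thesis using S_on[OF j True] S_on[OF i] xS[of p] by simp
  next
    case False
    then have "x p \<notin> C i" using im xi by (metis inj_image_mem_iff)
    then show ?thesis using False C_eq[OF i] C_eq[OF j] by simp
  qed
  then have 1: "x \<circ> T j = T i \<circ> x" by (simp add: fun_eq_iff)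
  have 2: "s = i" if "s \<in> {1..k}" "x \<circ> T j = T s \<circ> x" for s
  proof -
    have "x (T j q) \<noteq> x q" using q(1) C_eq[OF j] xi by (simp add: inj_eq)
    then have "T s (x q) \<noteq> x q" using that(2) by (metis comp_apply)
    then have "x q \<in> C s" using C_eq[OF that(1)] by blast
    then show ?thesis using C_disjoint that(1) i q(2) by blast
  qed
  have "(THE s. s \<in> {1..k} \<and> x \<circ> T j = T s \<circ> x) = i"
    using 1 2 i by (intro the_equality) auto
  then show ?thesis using j unfolding cent_image_def conj by simp
qed

end

section \<open>The decomposition of a centralizer element on the cycles of one length\<close>

locale block_decomp = cycle_family n k d T for n k d T +
  fixes \<sigma> \<beta> \<pi> \<mu> \<pi>0 :: "nat \<Rightarrow> nat" and z :: "nat \<Rightarrow> int" and h :: nat and x :: "nat \<Rightarrow> nat \<Rightarrow> nat"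
  assumes inj_\<sigma>: "inj \<sigma>" and inj_\<beta>: "inj \<beta>" and comm: "\<sigma> \<circ> \<beta> = \<beta> \<circ> \<sigma>"
    and \<sigma>_on: "q \<in> points \<Longrightarrow> \<sigma> q = S q" and \<beta>_on: "q \<in> points \<Longrightarrow> \<beta> q = \<pi> q"
    and \<pi>_eq: "\<pi> = \<mu> \<circ> \<pi>0"
    and \<pi>0_dichotomy: "j \<in> {1..k} \<Longrightarrow>
      (\<forall>q\<in>C j. \<pi>0 q = q) \<or> (\<exists>j'\<in>{1..k}. j' \<noteq> j \<and> \<pi>0 ` C j \<subseteq> C j')"
    and \<mu>_\<pi>0_disj: "disjoint_perms n \<mu> \<pi>0"
    and \<mu>_eq: "\<mu> = gprod (sym_group n) (\<lambda>j. T j [^]\<^bsub>sym_group n\<^esub> z j) k"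
    and x_cent: "t \<in> {1..h} \<Longrightarrow> x t \<in> cent0 n S"
    and x_cycle: "t \<in> {1..h} \<Longrightarrow> \<exists>m. is_cycle m (cent_image n k T (x t))"
    and x_disj: "\<lbrakk>t \<in> {1..h}; t' \<in> {1..h}; t \<noteq> t'\<rbrakk> \<Longrightarrow> disjoint_perms n (x t) (x t')"
    and \<pi>0_eq: "\<pi>0 = gprod (sym_group n) x h"
begin

abbreviation g :: "nat \<Rightarrow> nat \<Rightarrow> nat" where "g t \<equiv> cent_image n k T (x t)"

abbreviation M :: "nat \<Rightarrow> nat set" where "M t \<equiv> moved_cycles n k T (x t)"

lemma x_permutes_points: "t \<in> {1..h} \<Longrightarrow> x t permutes points"
  using x_cent movpts_S unfolding cent0_def by auto

lemma x_permutes: "t \<in> {1..h} \<Longrightarrow> x t permutes {1..n}"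
  by (rule permutes_subset[OF x_permutes_points]) (auto simp: movpts_def)

lemma \<pi>0_permutes: "\<pi>0 permutes {1..n}"
  unfolding \<pi>0_eq by (rule gprod_sym_permutes[OF x_permutes])

lemma \<mu>_on: "j \<in> {1..k} \<Longrightarrow> q \<in> C j \<Longrightarrow> \<mu> q = (S ^^ nat (z j mod int d)) q"
  unfolding \<mu>_eq by (rule gprod_powers_on)

lemma \<mu>_permutes: "\<mu> permutes {1..n}"
proof -
  have "T j [^]\<^bsub>sym_group n\<^esub> z j permutes {1..n}" if "j \<in> {1..k}" for j
    unfolding T_int_pow[OF that] by (rule permutes_funpow[OF T_perm[OF that]])
  then show ?thesis unfolding \<mu>_eq by (rule gprod_sym_permutes)
qed

lemma \<mu>_or_\<pi>0_fixes: "\<mu> q = q \<or> \<pi>0 q = q"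
  using \<mu>_\<pi>0_disj disjoint_perms_iff[OF \<mu>_permutes \<pi>0_permutes] by blast

lemma \<pi>0_x: "t \<in> {1..h} \<Longrightarrow> x t q \<noteq> q \<Longrightarrow> \<pi>0 q = x t q"
  unfolding \<pi>0_eq by (rule gprod_sym_moved[OF x_permutes x_disj])

lemma g_works:
  assumes "t \<in> {1..h}" "j \<in> {1..k}" "q \<in> C j"
  shows "g t j \<in> {1..k}" "x t q \<in> C (g t j)"
proof -
  have "x t q \<in> points"
    using permutes_in_image[OF x_permutes_points[OF assms(1)]] assms by blast
  then obtain i where i: "i \<in> {1..k}" "x t q \<in> C i" by blast
  have "g t j = i" by (rule cent_image_eqI[OF x_cent assms(2) i(1) assms(3) i(2)]) (rule assms)
  then show "g t j \<in> {1..k}" "x t q \<in> C (g t j)" using i by auto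
qed

lemma x_moves:
  assumes "t \<in> {1..h}" "j \<in> M t" "q \<in> C j"
  shows "x t q \<noteq> q"
proof -
  have j: "j \<in> {1..k}" "g t j \<noteq> j" using assms(2) unfolding moved_cycles_def by auto
  then show ?thesis using g_works[OF assms(1) j(1) assms(3)] C_disjoint[OF _ j(1) _ assms(3)] by metis
qed


text \<open>
  If \<open>x t\<close> moved a point within its cycle, then so would \<open>\<pi>0\<close>, whose factors are disjoint. But \<open>\<pi>0\<close>
  moves points only from one cycle to another.
\<close>
lemma x_moves_only:
  assumes t: "t \<in> {1..h}" and q: "x t q \<noteq> q"
  shows "\<exists>j\<in>M t. q \<in> C j"
proof -
  have "q \<in> points" using x_permutes_points[OF t] q by (meson permutes_not_in)
  then obtain j where j: "j \<in> {1..k}" "q \<in> C j" by blast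
  have "\<pi>0 q = x t q" by (rule \<pi>0_x[OF t q])
  then obtain j' where j': "j' \<in> {1..k}" "j' \<noteq> j" "x t q \<in> C j'"
    using \<pi>0_dichotomy[OF j(1)] j(2) q by fastforce
  have "g t j = j'" by (rule cent_image_eqI[OF x_cent[OF t] j(1) j'(1) j(2) j'(3)])
  then have "j \<in> M t" using j' j unfolding moved_cycles_def by simp
  then show ?thesis using j(2) by blast
qed

text \<open>
  The point \<open>x t q\<close> is moved by \<open>\<pi>0\<close> along with \<open>q\<close>, so the disjoint factor \<open>\<mu>\<close> fixes it.
\<close>
lemma \<beta>_moved:
  assumes "t \<in> {1..h}" "j \<in> M t" "q \<in> C j"
  shows "\<beta> q = x t q"
proof -
  have j: "j \<in> {1..k}" using assms(2) unfolding moved_cycles_def by auto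
  note q = x_moves[OF assms]
  have p: "\<pi>0 q = x t q" by (rule \<pi>0_x[OF assms(1) q])
  then have "\<pi>0 (x t q) \<noteq> x t q" using q permutes_inj[OF \<pi>0_permutes] by (metis injD)
  then have "\<mu> (x t q) = x t q" using \<mu>_or_\<pi>0_fixes by blast
  moreover have "\<beta> q = \<pi> q" using \<beta>_on j assms(3) by blast
  ultimately show ?thesis using p \<pi>_eq by simp
qed

lemma \<sigma>_rotates: "j \<in> {1..k} \<Longrightarrow> rotates \<sigma> (C j)"
  by (rule rotates_cong[OF S_rotates \<sigma>_on]) auto

lemma \<sigma>_funpow: "j \<in> {1..k} \<Longrightarrow> q \<in> C j \<Longrightarrow> (\<sigma> ^^ u) q = (S ^^ u) q"
proof (induction u)
  case (Suc u)
  have "(S ^^ u) q \<in> points"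
    using rotates_funpow_in[OF S_rotates Suc.prems(2)] Suc.prems(1) by blast
  then show ?case using Suc \<sigma>_on by simp
qed simp

lemma g_rotates:
  assumes "t \<in> {1..h}"
  shows "rotates (g t) (M t)" "card (M t) \<ge> 2"
    and "is_cycle m (g t) \<longleftrightarrow> m = card (M t)"
proof -
  obtain m' where m': "is_cycle m' (g t)" using x_cycle[OF assms] by blast
  have M: "M t = {j. g t j \<noteq> j}"
    unfolding moved_cycles_def by (auto simp: cent_image_def)
  show "rotates (g t) (M t)" "card (M t) \<ge> 2"
    unfolding M using is_cycle_rotates[OF m'] by auto
  show "is_cycle m (g t) \<longleftrightarrow> m = card (M t)"
    unfolding M using is_cycle_rotates(2) m' by blast
qed

lemma block_action: "block_action \<sigma> \<beta> C k d h (\<lambda>j. nat (z j mod int d)) g M"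
proof
  show "inj \<sigma>" "inj \<beta>" "\<sigma> \<circ> \<beta> = \<beta> \<circ> \<sigma>" by (fact inj_\<sigma> inj_\<beta> comm)+
  show "i = j" if "i \<in> {1..k}" "j \<in> {1..k}" "q \<in> C i" "q \<in> C j" for i j q
    using that by (rule C_disjoint)
  show "card (C j) = d" "rotates \<sigma> (C j)" if "j \<in> {1..k}" for j
    using card_C \<sigma>_rotates that by auto
  show M_sub: "M t \<subseteq> {1..k}" for t unfolding moved_cycles_def by blast
  show "t = t'" if t: "t \<in> {1..h}" "t' \<in> {1..h}" and j: "j \<in> M t" "j \<in> M t'" for t t' j
  proof (rule ccontr)
    assume "t \<noteq> t'"
    have "j \<in> {1..k}" using j(1) M_sub by blast
    then obtain q where q: "q \<in> C j" using C_nonempty by blast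
    have "x t q \<noteq> q" "x t' q \<noteq> q" using x_moves t j q by blast+
    then show False
      using x_disj[OF t \<open>t \<noteq> t'\<close>] disjoint_perms_iff[OF x_permutes[OF t(1)] x_permutes[OF t(2)]] by blast
  qed
  show "card (M t) \<ge> 2" "rotates (g t) (M t)" if "t \<in> {1..h}" for t
    using g_rotates[OF that] by auto
  show "\<beta> q \<in> C (g t j)" if "t \<in> {1..h}" "j \<in> M t" "q \<in> C j" for t j q
    unfolding \<beta>_moved[OF that] using g_works(2)[OF that(1) _ that(3)] M_sub that(2) by blast
  show "nat (z j mod int d) mod d = 0" if t: "t \<in> {1..h}" "j \<in> M t" for t j
  proof -
    have j: "j \<in> {1..k}" using t M_sub by blast
    then obtain q where q: "q \<in> C j" using C_nonempty by blast
    have "\<pi>0 q \<noteq> q" using \<pi>0_x x_moves t q by metis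
    then have "(S ^^ nat (z j mod int d)) q = (S ^^ 0) q"
      using \<mu>_or_\<pi>0_fixes[of q] \<mu>_on[OF j q] by simp
    then show ?thesis unfolding rotates_funpow_eq[OF S_rotates[OF j] q] card_C[OF j] by simp
  qed
  show "\<beta> q = (\<sigma> ^^ nat (z j mod int d)) q"
    if j: "j \<in> {1..k}" and unmoved: "j \<notin> (\<Union>t\<in>{1..h}. M t)" and q: "q \<in> C j" for j q
  proof -
    have "x t q = q" if t: "t \<in> {1..h}" for t
    proof (rule ccontr)
      assume "x t q \<noteq> q"
      then obtain i where "i \<in> M t" "q \<in> C i" using x_moves_only[OF t] by blast
      moreover have "i \<in> {1..k}" using M_sub \<open>i \<in> M t\<close> by blast
      ultimately show False using C_disjoint[OF _ j _ q] unmoved t by blast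
    qed
    then have "\<pi>0 q = q" unfolding \<pi>0_eq by (rule gprod_sym_fixed)
    moreover have "\<beta> q = \<pi> q" using \<beta>_on j q by blast
    ultimately show ?thesis using \<pi>_eq \<mu>_on[OF j q] \<sigma>_funpow[OF j q] by simp
  qed
qed

text \<open>
  On the cycles moved by \<open>x t\<close> the powers of \<open>x t\<close> agree with those of \<open>\<beta>\<close>; all other points are fixed by
  both sides of the equation that defines \<open>power_on_moved\<close>.
\<close>
lemma power_on_moved_iff:
  assumes t: "t \<in> {1..h}"
  shows "power_on_moved n k T (x t) m c \<longleftrightarrow>
    (\<forall>j\<in>M t. \<forall>q\<in>C j. (\<beta> ^^ m) q = (\<sigma> ^^ nat (c mod int d)) q)"
proof -
  let ?c = "\<lambda>j. if j \<in> M t then c else 0"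
  have M_sub: "j \<in> {1..k}" if "j \<in> M t" for j using that unfolding moved_cycles_def by blast
  have "(\<lambda>j. if j \<in> M t then T j [^]\<^bsub>sym_group n\<^esub> c else \<one>\<^bsub>sym_group n\<^esub>) =
      (\<lambda>j. T j [^]\<^bsub>sym_group n\<^esub> ?c j)"
    by auto
  then have iff: "power_on_moved n k T (x t) m c \<longleftrightarrow>
      x t ^^ m = gprod (sym_group n) (\<lambda>j. T j [^]\<^bsub>sym_group n\<^esub> ?c j) k"
    unfolding power_on_moved_def sym_group_nat_pow by simp
  have lhs: "(x t ^^ u) q = (\<beta> ^^ u) q \<and> (\<exists>i\<in>M t. (x t ^^ u) q \<in> C i)" if "j \<in> M t" "q \<in> C j" for j q u
  proof (induction u)
    case (Suc u)
    then obtain i where i: "i \<in> M t" "(x t ^^ u) q \<in> C i" by blast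
    have "g t i \<in> M t" using rotates_funpow_in[OF g_rotates(1)[OF t] i(1), of 1] by simp
    then show ?case
      using Suc i \<beta>_moved[OF t i] g_works(2)[OF t M_sub[OF i(1)] i(2)] by auto
  qed (use that in auto)
  have rhs: "gprod (sym_group n) (\<lambda>j. T j [^]\<^bsub>sym_group n\<^esub> ?c j) k q = (\<sigma> ^^ nat (c mod int d)) q"
    if "j \<in> M t" "q \<in> C j" for j q
    using gprod_powers_on[OF M_sub that(2), of ?c] \<sigma>_funpow[OF M_sub that(2)] that(1) by simp
  have outside: "(x t ^^ m) q = gprod (sym_group n) (\<lambda>j. T j [^]\<^bsub>sym_group n\<^esub> ?c j) k q"
    if q: "\<not> (\<exists>j\<in>M t. q \<in> C j)" for q
  proof -
    have "x t q = q" using x_moves_only[OF t] q by blast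
    then have "(x t ^^ m) q = q" by (induction m) simp_all
    moreover have "gprod (sym_group n) (\<lambda>j. T j [^]\<^bsub>sym_group n\<^esub> ?c j) k q = q"
    proof (cases "q \<in> points")
      case True
      then obtain j where j: "j \<in> {1..k}" "q \<in> C j" by blast
      then have "j \<notin> M t" using q by blast
      then show ?thesis using gprod_powers_on[OF j, of ?c] by simp
    qed (rule gprod_powers_off)
    ultimately show ?thesis by simp
  qed
  show ?thesis
  proof
    assume "power_on_moved n k T (x t) m c"
    then show "\<forall>j\<in>M t. \<forall>q\<in>C j. (\<beta> ^^ m) q = (\<sigma> ^^ nat (c mod int d)) q"
      unfolding iff using lhs rhs by metis
  next
    assume *: "\<forall>j\<in>M t. \<forall>q\<in>C j. (\<beta> ^^ m) q = (\<sigma> ^^ nat (c mod int d)) q"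
    show "power_on_moved n k T (x t) m c" unfolding iff
    proof
      fix q
      show "(x t ^^ m) q = gprod (sym_group n) (\<lambda>j. T j [^]\<^bsub>sym_group n\<^esub> ?c j) k q"
      proof (cases "\<exists>j\<in>M t. q \<in> C j")
        case True
        then obtain j where j: "j \<in> M t" "q \<in> C j" by blast
        then have "(x t ^^ m) q = (\<beta> ^^ m) q" using lhs by blast
        then show ?thesis using * j rhs[OF j] by metis
      qed (rule outside)
    qed
  qed
qed

lemma power_on_moved_of_nat:
  assumes t: "t \<in> {1..h}"
  shows "power_on_moved n k T (x t) m (int c) \<longleftrightarrow>
    (\<forall>j\<in>M t. \<forall>q\<in>C j. (\<beta> ^^ m) q = (\<sigma> ^^ c) q)"
proof -
  have "(\<sigma> ^^ nat (int c mod int d)) q = (\<sigma> ^^ c) q" if "j \<in> M t" "q \<in> C j" for j q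
  proof -
    have j: "j \<in> {1..k}" using that(1) unfolding moved_cycles_def by blast
    show ?thesis
      unfolding rotates_funpow_eq[OF \<sigma>_rotates[OF j] that(2)] card_C[OF j]
      by (simp flip: of_nat_mod)
  qed
  then show ?thesis unfolding power_on_moved_iff[OF t] by simp
qed

end

section \<open>Conjugate homomorphisms and the decomposition over all cycle lengths\<close>

lemma conjugate_in_sym_group:
  "conjugate_in (sym_group n) p p' \<longleftrightarrow> (\<exists>w. w permutes {1..n} \<and> (\<forall>q. w (p q) = p' (w q)))"
proof -
  have "w \<otimes>\<^bsub>sym_group n\<^esub> p \<otimes>\<^bsub>sym_group n\<^esub> inv\<^bsub>sym_group n\<^esub> w = p' \<longleftrightarrow> w \<circ> p = p' \<circ> w"
    if w: "w permutes {1..n}" for w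
  proof -
    have inv: "inv\<^bsub>sym_group n\<^esub> w = inv' w"
      using w by (simp add: sym_group_inv_equality sym_group_carrier)
    have "w \<circ> p = p' \<circ> w" if "w \<circ> p \<circ> inv' w = p'"
      unfolding that[symmetric] comp_assoc permutes_inv_o(2)[OF w] by simp
    moreover have "w \<circ> p \<circ> inv' w = p'" if "w \<circ> p = p' \<circ> w"
      unfolding that comp_assoc permutes_inv_o(1)[OF w] by simp
    ultimately show ?thesis unfolding sym_group_mult inv by blast
  qed
  then show ?thesis unfolding conjugate_in_def Bex_def sym_group_carrier fun_eq_iff comp_apply by blast
qed

text \<open>
  The elements on which \<open>w\<close> intertwines the two homomorphisms are closed under products and inverses,
  so it suffices to test generators.
\<close>
lemma conjugate_homs_sym_group:
  assumes "group A" and \<phi>: "\<phi> \<in> hom A (sym_group n)" and \<psi>: "\<psi> \<in> hom A (sym_group n)"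
    and "B \<subseteq> carrier A" "generate A B = carrier A"
  shows "conjugate_homs A (sym_group n) \<phi> \<psi> \<longleftrightarrow>
    (\<exists>w. w permutes {1..n} \<and> (\<forall>g\<in>B. \<forall>q. w (\<phi> g q) = \<psi> g (w q)))"
proof -
  interpret G: group A by fact
  interpret S: group "sym_group n" by (rule sym_group_is_group)
  interpret \<phi>: group_hom A "sym_group n" \<phi> using \<phi> by unfold_locales
  interpret \<psi>: group_hom A "sym_group n" \<psi> using \<psi> by unfold_locales
  have conj: "w \<otimes>\<^bsub>sym_group n\<^esub> p \<otimes>\<^bsub>sym_group n\<^esub> inv\<^bsub>sym_group n\<^esub> w = p' \<longleftrightarrow>
      w \<otimes>\<^bsub>sym_group n\<^esub> p = p' \<otimes>\<^bsub>sym_group n\<^esub> w"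
    if "w \<in> carrier (sym_group n)" "p \<in> carrier (sym_group n)" "p' \<in> carrier (sym_group n)" for w p p'
    using S.inv_solve_right'[OF _ _ that(1), of p' "w \<otimes>\<^bsub>sym_group n\<^esub> p"] that by simp
  have all: "w \<otimes>\<^bsub>sym_group n\<^esub> \<phi> g = \<psi> g \<otimes>\<^bsub>sym_group n\<^esub> w"
    if w: "w \<in> carrier (sym_group n)" and B: "\<And>g. g \<in> B \<Longrightarrow> w \<otimes>\<^bsub>sym_group n\<^esub> \<phi> g = \<psi> g \<otimes>\<^bsub>sym_group n\<^esub> w"
      and g: "g \<in> generate A B" for w g
    using g
  proof (induction g)
    case one
    show ?case using w by simp
  next
    case (incl g)
    then show ?case by (rule B)
  next
    case (inv g)
    then have g: "g \<in> carrier A" using assms(4) by blast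
    then have c: "\<phi> g \<in> carrier (sym_group n)" "\<psi> g \<in> carrier (sym_group n)" by auto
    note w\<phi> = S.m_closed[OF w S.inv_closed[OF c(1)]]
    have "w = \<psi> g \<otimes>\<^bsub>sym_group n\<^esub> w \<otimes>\<^bsub>sym_group n\<^esub> inv\<^bsub>sym_group n\<^esub> \<phi> g"
      by (rule iffD2[OF S.inv_solve_right[OF w S.m_closed[OF c(2) w] c(1)] B[OF inv, symmetric]])
    also have "\<dots> = \<psi> g \<otimes>\<^bsub>sym_group n\<^esub> (w \<otimes>\<^bsub>sym_group n\<^esub> inv\<^bsub>sym_group n\<^esub> \<phi> g)"
      by (rule S.m_assoc[OF c(2) w S.inv_closed[OF c(1)]])
    finally have "w \<otimes>\<^bsub>sym_group n\<^esub> inv\<^bsub>sym_group n\<^esub> \<phi> g = inv\<^bsub>sym_group n\<^esub> \<psi> g \<otimes>\<^bsub>sym_group n\<^esub> w"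
      by (rule iffD2[OF S.inv_solve_left[OF w\<phi> c(2) w]])
    then show ?case by (simp only: \<phi>.hom_inv[OF g] \<psi>.hom_inv[OF g])
  next
    case (eng g g')
    then have g: "g \<in> carrier A" "g' \<in> carrier A" using assms(5) by auto
    then have c: "\<phi> g \<in> carrier (sym_group n)" "\<phi> g' \<in> carrier (sym_group n)"
      "\<psi> g \<in> carrier (sym_group n)" "\<psi> g' \<in> carrier (sym_group n)" by auto
    have "w \<otimes>\<^bsub>sym_group n\<^esub> \<phi> (g \<otimes>\<^bsub>A\<^esub> g') = (w \<otimes>\<^bsub>sym_group n\<^esub> \<phi> g) \<otimes>\<^bsub>sym_group n\<^esub> \<phi> g'"
      using g c w by (simp add: S.m_assoc)
    also have "\<dots> = \<psi> g \<otimes>\<^bsub>sym_group n\<^esub> (w \<otimes>\<^bsub>sym_group n\<^esub> \<phi> g')"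
      using c w by (simp only: eng.IH S.m_assoc)
    also have "\<dots> = \<psi> (g \<otimes>\<^bsub>A\<^esub> g') \<otimes>\<^bsub>sym_group n\<^esub> w"
      using g c w by (simp add: eng.IH S.m_assoc)
    finally show ?case .
  qed
  have "conjugate_homs A (sym_group n) \<phi> \<psi> \<longleftrightarrow>
      (\<exists>w\<in>carrier (sym_group n). \<forall>g\<in>carrier A. w \<otimes>\<^bsub>sym_group n\<^esub> \<phi> g = \<psi> g \<otimes>\<^bsub>sym_group n\<^esub> w)"
    unfolding conjugate_homs_def using conj by (intro bex_cong ball_cong refl) auto
  also have "\<dots> \<longleftrightarrow> (\<exists>w\<in>carrier (sym_group n). \<forall>g\<in>B. w \<otimes>\<^bsub>sym_group n\<^esub> \<phi> g = \<psi> g \<otimes>\<^bsub>sym_group n\<^esub> w)"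
  proof (intro bex_cong refl iffI ballI)
    fix w g
    assume w: "w \<in> carrier (sym_group n)"
    { assume "\<forall>g\<in>carrier A. w \<otimes>\<^bsub>sym_group n\<^esub> \<phi> g = \<psi> g \<otimes>\<^bsub>sym_group n\<^esub> w" and "g \<in> B"
      then show "w \<otimes>\<^bsub>sym_group n\<^esub> \<phi> g = \<psi> g \<otimes>\<^bsub>sym_group n\<^esub> w" using assms(4) by blast }
    { assume B: "\<forall>g\<in>B. w \<otimes>\<^bsub>sym_group n\<^esub> \<phi> g = \<psi> g \<otimes>\<^bsub>sym_group n\<^esub> w" and "g \<in> carrier A"
      then have "g \<in> generate A B" by (simp only: assms(5))
      from all[OF w bspec[OF B] this]
      show "w \<otimes>\<^bsub>sym_group n\<^esub> \<phi> g = \<psi> g \<otimes>\<^bsub>sym_group n\<^esub> w" . }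
  qed
  finally show ?thesis unfolding Bex_def sym_group_carrier sym_group_mult fun_eq_iff comp_apply .
qed

locale grouped_perm =
  fixes n l :: nat and \<sigma> :: "nat \<Rightarrow> nat" and k d :: "nat \<Rightarrow> nat" and \<tau> :: "nat \<Rightarrow> nat \<Rightarrow> nat \<Rightarrow> nat"
  assumes grouping: "cycle_grouping n \<sigma> l k d \<tau>"
begin

abbreviation block :: "nat \<Rightarrow> nat \<Rightarrow> nat" where "block \<equiv> cycle_block n k \<tau>"

abbreviation B :: "nat \<Rightarrow> nat set" where "B i \<equiv> \<Union>j\<in>{1..k i}. movpts n (\<tau> i j)"

abbreviation F :: "nat set" where "F \<equiv> fixpts n \<sigma>"

lemma family:
  assumes i: "i \<in> {1..l}"
  shows "cycle_family n (k i) (d i) (\<tau> i)"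
proof
  have \<tau>: "\<forall>j\<in>{1..k i}. \<tau> i j \<in> carrier (sym_group n) \<and> is_cycle (d i) (\<tau> i j)"
    using grouping i unfolding cycle_grouping_def by blast
  then show "\<tau> i j permutes {1..n}" "is_cycle (d i) (\<tau> i j)" if "j \<in> {1..k i}" for j
    using that by (simp_all add: sym_group_carrier)
  show "disjoint_perms n (\<tau> i j) (\<tau> i j')" if "j \<in> {1..k i}" "j' \<in> {1..k i}" "j \<noteq> j'" for j j'
    using grouping i that unfolding cycle_grouping_def by blast
qed

lemma lengths_inj: "i \<in> {1..l} \<Longrightarrow> i' \<in> {1..l} \<Longrightarrow> d i = d i' \<Longrightarrow> i = i'"
  using grouping unfolding cycle_grouping_def inj_on_def by blast

lemma movpts_block: "i \<in> {1..l} \<Longrightarrow> movpts n (block i) = B i"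
  unfolding cycle_block_def by (rule cycle_family.movpts_S[OF family])

lemma block_permutes: "i \<in> {1..l} \<Longrightarrow> block i permutes {1..n}"
  unfolding cycle_block_def by (rule cycle_family.S_permutes[OF family])

lemma block_moves_iff: "i \<in> {1..l} \<Longrightarrow> block i q \<noteq> q \<longleftrightarrow> q \<in> B i"
  using movpts_block movpts_permutes[OF block_permutes] by blast

lemma B_disjoint:
  assumes i: "i \<in> {1..l}" "i' \<in> {1..l}" and q: "q \<in> B i" "q \<in> B i'"
  shows "i = i'"
proof (rule ccontr)
  assume "i \<noteq> i'"
  obtain j j' where j: "j \<in> {1..k i}" "q \<in> movpts n (\<tau> i j)" "j' \<in> {1..k i'}" "q \<in> movpts n (\<tau> i' j')"
    using q by blast
  then have "disjoint_perms n (\<tau> i j) (\<tau> i' j')"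
    using grouping i \<open>i \<noteq> i'\<close> unfolding cycle_grouping_def by blast
  then show False using j unfolding disjoint_perms_def by blast
qed

lemma blocks_disjoint:
  assumes "i \<in> {1..l}" "i' \<in> {1..l}" "i \<noteq> i'"
  shows "disjoint_perms n (block i) (block i')"
  using B_disjoint[OF assms(1,2)] assms(3)
  unfolding disjoint_perms_def movpts_block[OF assms(1)] movpts_block[OF assms(2)] by blast

lemma \<sigma>_eq: "\<sigma> = gprod (sym_group n) block l"
  using grouping unfolding cycle_grouping_def by blast

lemma \<sigma>_permutes: "\<sigma> permutes {1..n}"
  unfolding \<sigma>_eq by (rule gprod_sym_permutes[OF block_permutes])

lemma \<sigma>_on: "i \<in> {1..l} \<Longrightarrow> q \<in> B i \<Longrightarrow> \<sigma> q = block i q"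
  using gprod_sym_moved[of l block n, OF block_permutes blocks_disjoint, of i q] block_moves_iff[of i q]
  unfolding \<sigma>_eq by blast

lemma \<sigma>_moves_iff: "\<sigma> q \<noteq> q \<longleftrightarrow> (\<exists>i\<in>{1..l}. q \<in> B i)"
proof
  assume "\<sigma> q \<noteq> q"
  then show "\<exists>i\<in>{1..l}. q \<in> B i"
    unfolding \<sigma>_eq using gprod_sym_fixed[of l block q n] block_moves_iff by blast
next
  assume "\<exists>i\<in>{1..l}. q \<in> B i"
  then obtain i where i: "i \<in> {1..l}" "q \<in> B i" by blast
  then have "block i q \<noteq> q" using block_moves_iff by blast
  then show "\<sigma> q \<noteq> q" unfolding \<sigma>_on[OF i] .
qed

lemma B_sub: "B i \<subseteq> {1..n}" by (auto simp: movpts_def)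

lemma F_eq: "F = {1..n} - (\<Union>i\<in>{1..l}. B i)"
  using \<sigma>_moves_iff unfolding fixpts_def by blast

lemma card_points_eq:
  "card {q \<in> {1..n}. R q} = card {q \<in> F. R q} + (\<Sum>i\<in>{1..l}. card {q \<in> B i. R q})"
proof -
  have "(\<Union>i\<in>{1..l}. B i) \<subseteq> {1..n}" using B_sub by blast
  then have points: "{q \<in> {1..n}. R q} = {q \<in> F. R q} \<union> (\<Union>i\<in>{1..l}. {q \<in> B i. R q})"
    unfolding F_eq by blast
  have "card ({q \<in> F. R q} \<union> (\<Union>i\<in>{1..l}. {q \<in> B i. R q})) = card {q \<in> F. R q} + card (\<Union>i\<in>{1..l}. {q \<in> B i. R q})"
  proof (rule card_Un_disjoint)
    show "finite {q \<in> F. R q}" by (simp add: fixpts_def)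
    show "finite (\<Union>i\<in>{1..l}. {q \<in> B i. R q})" by (simp add: movpts_def)
    show "{q \<in> F. R q} \<inter> (\<Union>i\<in>{1..l}. {q \<in> B i. R q}) = {}" unfolding F_eq by blast
  qed
  moreover have "card (\<Union>i\<in>{1..l}. {q \<in> B i. R q}) = (\<Sum>i\<in>{1..l}. card {q \<in> B i. R q})"
  proof (rule card_UN_disjoint)
    show "\<forall>i\<in>{1..l}. finite {q \<in> B i. R q}"
    proof
      fix i
      have "{q \<in> B i. R q} \<subseteq> {1..n}" using B_sub[of i] by (rule subset_trans[rotated]) (rule Collect_restrict)
      then show "finite {q \<in> B i. R q}" by (rule finite_subset) (rule finite_atLeastAtMost)
    qed
    show "\<forall>i\<in>{1..l}. \<forall>i'\<in>{1..l}. i \<noteq> i' \<longrightarrow> {q \<in> B i. R q} \<inter> {q \<in> B i'. R q} = {}"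
    proof (intro ballI impI equals0I)
      fix i i' q assume i: "i \<in> {1..l}" "i' \<in> {1..l}" "i \<noteq> i'" "q \<in> {q \<in> B i. R q} \<inter> {q \<in> B i'. R q}"
      then have "q \<in> B i" "q \<in> B i'" by simp_all
      then show False using B_disjoint[OF i(1,2)] i(3) by blast
    qed
  qed simp
  ultimately show ?thesis by (simp only: points)
qed

end

locale decomposed_perm = grouped_perm n l \<sigma> k d \<tau> for n l \<sigma> k d \<tau> +
  fixes \<rho> \<mu>0 :: "nat \<Rightarrow> nat" and \<pi> \<mu> \<pi>0 :: "nat \<Rightarrow> nat \<Rightarrow> nat" and z :: "nat \<Rightarrow> nat \<Rightarrow> int"
    and h :: "nat \<Rightarrow> nat" and x :: "nat \<Rightarrow> nat \<Rightarrow> nat \<Rightarrow> nat"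
  assumes \<rho>_permutes: "\<rho> permutes {1..n}" and comm: "\<sigma> \<circ> \<rho> = \<rho> \<circ> \<sigma>"
    and decomp: "cent_decomp n \<sigma> l k \<tau> \<rho> \<mu>0 \<pi> \<mu> \<pi>0 z h x"
begin

abbreviation M :: "nat \<Rightarrow> nat \<Rightarrow> nat set" where "M i t \<equiv> moved_cycles n (k i) (\<tau> i) (x i t)"

abbreviation g :: "nat \<Rightarrow> nat \<Rightarrow> nat \<Rightarrow> nat" where "g i t \<equiv> cent_image n (k i) (\<tau> i) (x i t)"

lemma \<mu>0_permutes: "\<mu>0 permutes F"
  using decomp unfolding cent_decomp_def by blast

lemma \<pi>_permutes_B: "i \<in> {1..l} \<Longrightarrow> \<pi> i permutes B i"
proof -
  assume i: "i \<in> {1..l}"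
  then have "\<pi> i \<in> cent0 n (block i)" using decomp unfolding cent_decomp_def by blast
  then show ?thesis unfolding cent0_def movpts_block[OF i] by blast
qed

lemma \<pi>_permutes: "i \<in> {1..l} \<Longrightarrow> \<pi> i permutes {1..n}"
  by (rule permutes_subset[OF \<pi>_permutes_B B_sub])

lemma \<pi>_fixes: "i \<in> {1..l} \<Longrightarrow> q \<notin> B i \<Longrightarrow> \<pi> i q = q"
  by (rule permutes_not_in[OF \<pi>_permutes_B])

lemma \<rho>_eq: "\<rho> = \<mu>0 \<circ> gprod (sym_group n) \<pi> l"
  using decomp unfolding cent_decomp_def sym_group_mult by blast

lemma \<rho>_on_F: "q \<in> F \<Longrightarrow> \<rho> q = \<mu>0 q"
proof -
  assume "q \<in> F"
  then have "\<pi> i q = q" if "i \<in> {1..l}" for i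
    using \<pi>_fixes[OF that] that unfolding F_eq by blast
  then have "gprod (sym_group n) \<pi> l q = q" by (rule gprod_sym_fixed)
  then show ?thesis by (simp add: \<rho>_eq)
qed

text \<open>
  The factors \<open>\<pi> i'\<close> of the other cycle lengths fix \<open>q\<close>, and \<open>\<mu>0\<close> fixes \<open>\<pi> i q\<close>, which lies on a cycle of
  length \<open>d i\<close> again.
\<close>
lemma \<rho>_on_B:
  assumes i: "i \<in> {1..l}" and q: "q \<in> B i"
  shows "\<rho> q = \<pi> i q"
proof -
  have "gprod (sym_group n) \<pi> l q = \<pi> i q"
  proof (cases "\<pi> i q = q")
    case True
    then have "\<pi> i' q = q" if "i' \<in> {1..l}" for i'
      using \<pi>_fixes[OF that] B_disjoint[OF that i _ q] by blast
    then have "gprod (sym_group n) \<pi> l q = q" by (rule gprod_sym_fixed)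
    then show ?thesis using True by simp
  next
    case False
    have "disjoint_perms n (\<pi> i1) (\<pi> i2)" if i12: "i1 \<in> {1..l}" "i2 \<in> {1..l}" "i1 \<noteq> i2" for i1 i2
      unfolding disjoint_perms_iff[OF \<pi>_permutes[OF i12(1)] \<pi>_permutes[OF i12(2)]]
    proof
      fix p
      have "p \<notin> B i1 \<or> p \<notin> B i2" using B_disjoint[OF i12(1,2)] i12(3) by blast
      then show "\<pi> i1 p = p \<or> \<pi> i2 p = p" using \<pi>_fixes i12(1,2) by blast
    qed
    from gprod_sym_moved[of l \<pi> n, OF \<pi>_permutes this i False] show ?thesis .
  qed
  moreover have "\<pi> i q \<in> B i" using permutes_in_image[OF \<pi>_permutes_B[OF i]] q by blast
  then have "\<pi> i q \<notin> F" unfolding F_eq using i by blast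
  then have "\<mu>0 (\<pi> i q) = \<pi> i q" by (rule permutes_not_in[OF \<mu>0_permutes])
  ultimately show ?thesis unfolding \<rho>_eq by simp
qed

lemma block_decomp:
  assumes i: "i \<in> {1..l}"
  shows "block_decomp n (k i) (d i) (\<tau> i) \<sigma> \<rho> (\<pi> i) (\<mu> i) (\<pi>0 i) (z i) (h i) (x i)"
proof -
  have D: "\<pi> i = \<mu> i \<circ> \<pi>0 i"
    "\<forall>j\<in>{1..k i}. (\<forall>q\<in>movpts n (\<tau> i j). \<pi>0 i q = q) \<or>
       (\<exists>j'\<in>{1..k i}. j' \<noteq> j \<and> \<pi>0 i ` movpts n (\<tau> i j) \<subseteq> movpts n (\<tau> i j'))"
    "disjoint_perms n (\<mu> i) (\<pi>0 i)"
    "\<mu> i = gprod (sym_group n) (\<lambda>j. \<tau> i j [^]\<^bsub>sym_group n\<^esub> z i j) (k i)"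
    "\<forall>j\<in>{1..h i}. x i j \<in> cent0 n (gprod (sym_group n) (\<tau> i) (k i))"
    "\<forall>j\<in>{1..h i}. \<exists>m. is_cycle m (cent_image n (k i) (\<tau> i) (x i j))"
    "\<forall>j\<in>{1..h i}. \<forall>j'\<in>{1..h i}. j \<noteq> j' \<longrightarrow> disjoint_perms n (x i j) (x i j')"
    "\<pi>0 i = gprod (sym_group n) (x i) (h i)"
    using decomp i unfolding cent_decomp_def cycle_block_def sym_group_mult by blast+
  show ?thesis
  proof (intro block_decomp.intro block_decomp_axioms.intro)
    show "cycle_family n (k i) (d i) (\<tau> i)" by (rule family[OF i])
    show "inj \<sigma>" "inj \<rho>" using permutes_inj \<sigma>_permutes \<rho>_permutes by auto
    show "\<sigma> q = gprod (sym_group n) (\<tau> i) (k i) q" if "q \<in> B i" for q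
      using \<sigma>_on[OF i that] unfolding cycle_block_def .
    show "\<rho> q = \<pi> i q" if "q \<in> B i" for q by (rule \<rho>_on_B[OF i that])
    show "\<sigma> \<circ> \<rho> = \<rho> \<circ> \<sigma>" by (rule comm)
    show "\<pi> i = \<mu> i \<circ> \<pi>0 i" "disjoint_perms n (\<mu> i) (\<pi>0 i)"
      "\<mu> i = gprod (sym_group n) (\<lambda>j. \<tau> i j [^]\<^bsub>sym_group n\<^esub> z i j) (k i)"
      "\<pi>0 i = gprod (sym_group n) (x i) (h i)"
      by (fact D)+
    show "(\<forall>q\<in>movpts n (\<tau> i j). \<pi>0 i q = q) \<or>
        (\<exists>j'\<in>{1..k i}. j' \<noteq> j \<and> \<pi>0 i ` movpts n (\<tau> i j) \<subseteq> movpts n (\<tau> i j'))"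
      if "j \<in> {1..k i}" for j using D(2) that by (rule bspec)
    show "x i t \<in> cent0 n (gprod (sym_group n) (\<tau> i) (k i))"
      and "\<exists>m. is_cycle m (cent_image n (k i) (\<tau> i) (x i t))" if "t \<in> {1..h i}" for t
      by (rule bspec[OF D(5) that] bspec[OF D(6) that])+
    show "disjoint_perms n (x i t) (x i t')" if "t \<in> {1..h i}" "t' \<in> {1..h i}" "t \<noteq> t'" for t t'
      using bspec[OF bspec[OF D(7) that(1)] that(2)] that(3) by (rule mp)
  qed
qed

lemma block_action:
  assumes "i \<in> {1..l}"
  shows "block_action \<sigma> \<rho> (\<lambda>j. movpts n (\<tau> i j)) (k i) (d i) (h i) (\<lambda>j. nat (z i j mod int (d i))) (g i) (M i)"
  by (rule block_decomp.block_action[OF block_decomp[OF assms]])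

end

section \<open>Two permutations commuting with the same permutation\<close>

lemma mod_residue_iff_cong:
  fixes a b :: int
  assumes "d > 0"
  shows "nat (a mod int d) mod d = nat (b mod int d) mod d \<longleftrightarrow> [a = b] (mod int d)"
proof -
  have "nat (c mod int d) mod d = nat (c mod int d)" for c
    using assms by (intro mod_less) (simp add: nat_less_iff)
  moreover have "nat (a mod int d) = nat (b mod int d) \<longleftrightarrow> a mod int d = b mod int d"
    using assms by (intro eq_nat_nat_iff) simp_all
  ultimately show ?thesis by (simp only: cong_def)
qed

lemma card_Collect_permutes:
  assumes v: "v permutes A" and R: "\<And>q. q \<in> A \<Longrightarrow> R q \<longleftrightarrow> R' (v q)"
  shows "card {q \<in> A. R q} = card {q \<in> A. R' q}"
proof -
  have "v ` {q \<in> A. R q} = {q \<in> A. R' q}"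
  proof
    show "v ` {q \<in> A. R q} \<subseteq> {q \<in> A. R' q}"
      using permutes_in_image[OF v] R by blast
    show "{q \<in> A. R' q} \<subseteq> v ` {q \<in> A. R q}"
    proof
      fix q assume q: "q \<in> {q \<in> A. R' q}"
      then obtain p where "p \<in> A" "q = v p" using permutes_image[OF v] by blast
      then show "q \<in> v ` {q \<in> A. R q}" using q R by blast
    qed
  qed
  then show ?thesis using card_image[OF permutes_inj_on[OF v]] by metis
qed

locale decomposed_pair =
  P: decomposed_perm n l \<sigma> k d \<tau> \<rho> \<mu>0 \<pi> \<mu> \<pi>0 z h x +
  Q: decomposed_perm n l \<sigma> k d \<tau> \<rho>' \<mu>0' \<pi>' \<mu>' \<pi>0' z' h' y
  for n l \<sigma> k d \<tau> \<rho> \<mu>0 \<pi> \<mu> \<pi>0 z h x \<rho>' \<mu>0' \<pi>' \<mu>' \<pi>0' z' h' y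
begin

lemma block_pair:
  "i \<in> {1..l} \<Longrightarrow> block_pair \<sigma> \<rho> (\<lambda>j. movpts n (\<tau> i j)) (k i) (d i)
    (h i) (\<lambda>j. nat (z i j mod int (d i))) (P.g i) (P.M i) \<rho>'
    (h' i) (\<lambda>j. nat (z' i j mod int (d i))) (Q.g i) (Q.M i)"
  using P.block_action Q.block_action by (intro block_pair.intro)

context
  fixes w :: "nat \<Rightarrow> nat"
  assumes w: "w permutes {1..n}" and w\<sigma>: "\<And>q. w (\<sigma> q) = \<sigma> (w q)" and w\<rho>: "\<And>q. w (\<rho> q) = \<rho>' (w q)"
begin

text \<open>
  A map commuting with \<open>\<sigma>\<close> preserves the period of a point, and different blocks have different cycle lengths.
\<close>
lemma conjugator_preserves_B:
  assumes i: "i \<in> {1..l}" and q: "q \<in> P.B i"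
  shows "w q \<in> P.B i"
proof -
  have inj: "inj w" using permutes_inj[OF w] .
  have ws: "w ((\<sigma> ^^ u) p) = (\<sigma> ^^ u) (w p)" for u p by (induction u) (simp_all add: w\<sigma>)
  have "\<sigma> q \<noteq> q" using P.\<sigma>_moves_iff i q by blast
  then have "\<sigma> (w q) \<noteq> w q" using inj_eq[OF inj] by (simp flip: w\<sigma>)
  then obtain i' where i': "i' \<in> {1..l}" "w q \<in> P.B i'" using P.\<sigma>_moves_iff by blast
  obtain j j' where j: "j \<in> {1..k i}" "q \<in> movpts n (\<tau> i j)"
    and j': "j' \<in> {1..k i'}" "w q \<in> movpts n (\<tau> i' j')" using q i'(2) by blast
  have "u mod d i = v mod d i \<longleftrightarrow> u mod d i' = v mod d i'" for u v
    unfolding block_action.C_period[OF P.block_action[OF i] j, symmetric]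
      block_action.C_period[OF P.block_action[OF i'(1)] j', symmetric]
      ws[symmetric] inj_eq[OF inj] ..
  from this[of _ 0] have "d i dvd u \<longleftrightarrow> d i' dvd u" for u by (simp add: mod_eq_0_iff_dvd)
  from this[of "d i"] this[of "d i'"] have "d i = d i'" by (intro dvd_antisym) simp_all
  then show ?thesis using P.lengths_inj[OF i i'(1)] i'(2) by blast
qed

text \<open>
  The restriction of \<open>w\<close> to the fixed points of \<open>\<sigma>\<close>, extended by the identity, conjugates \<open>\<mu>0\<close> to \<open>\<mu>0'\<close>.
\<close>
lemma conjugate_fixed_parts:
  "\<exists>v. v permutes {1..n} \<and> (\<forall>q. v (\<mu>0 q) = \<mu>0' (v q))"
proof -
  define v where "v q = (if q \<in> P.F then w q else q)" for q
  have fix_iff: "w q \<in> P.F \<longleftrightarrow> q \<in> P.F" for q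
    using permutes_in_image[OF w, of q] inj_eq[OF permutes_inj[OF w], of "\<sigma> q" q]
    unfolding fixpts_def mem_Collect_eq w\<sigma> by blast
  have "finite P.F" by (simp add: fixpts_def)
  have "bij_betw v P.F P.F"
    using fix_iff permutes_inj_on[OF w] endo_inj_surj[OF \<open>finite P.F\<close>, of w]
    by (auto simp: bij_betw_def v_def inj_on_def image_iff)
  then have "v permutes P.F" by (rule bij_imp_permutes) (simp add: v_def)
  then have "v permutes {1..n}" by (rule permutes_subset) (auto simp: fixpts_def)
  moreover have "v (\<mu>0 q) = \<mu>0' (v q)" for q
  proof (cases "q \<in> P.F")
    case True
    then have "\<mu>0 q \<in> P.F" using permutes_in_image[OF P.\<mu>0_permutes] by blast
    then have "v (\<mu>0 q) = w (\<rho> q)" using P.\<rho>_on_F[OF True] by (simp add: v_def)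
    also have "\<dots> = \<mu>0' (v q)"
      using Q.\<rho>_on_F[of "w q"] fix_iff True by (simp add: v_def w\<rho>)
    finally show ?thesis .
  next
    case False
    then show ?thesis
      using permutes_not_in[OF P.\<mu>0_permutes False] permutes_not_in[OF Q.\<mu>0_permutes False]
      by (simp add: v_def)
  qed
  ultimately show ?thesis by blast
qed

text \<open>
  The permutation of the cycles of length \<open>d i\<close> induced by \<open>w\<close> preserves exponents and carries moved orbits
  to moved orbits with the same return exponents.
\<close>
lemma block_invariants:
  assumes i: "i \<in> {1..l}"
  shows "\<exists>r. r permutes {1..k i} \<and> (\<forall>j\<in>{1..k i}. [z i j = z' i (r j)] (mod int (d i)))"
    and "\<exists>f. f ` {1..h i} \<subseteq> {1..h' i} \<and> inj_on f {1..h i} \<and>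
       (\<forall>j\<in>{1..h i}. \<forall>m.
          is_cycle m (P.g i j) \<longrightarrow> is_cycle m (Q.g i (f j)) \<and>
          (\<exists>c::int. power_on_moved n (k i) (\<tau> i) (x i j) m c \<and>
                    power_on_moved n (k i) (\<tau> i) (y i (f j)) m c))"
proof -
  interpret BP: block_pair \<sigma> \<rho> "\<lambda>j. movpts n (\<tau> i j)" "k i" "d i"
    "h i" "\<lambda>j. nat (z i j mod int (d i))" "P.g i" "P.M i" \<rho>'
    "h' i" "\<lambda>j. nat (z' i j mod int (d i))" "Q.g i" "Q.M i"
    by (rule block_pair[OF i])
  have inj: "inj w" using permutes_inj[OF w] .
  have "w ` P.B i \<subseteq> P.B i" using conjugator_preserves_B[OF i] by blast
  then obtain r where r: "r permutes {1..k i}"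
    "\<And>j q. j \<in> {1..k i} \<Longrightarrow> q \<in> movpts n (\<tau> i j) \<Longrightarrow> w q \<in> movpts n (\<tau> i (r j))"
    using BP.equivariant_permutation[OF inj w\<sigma>] by metis
  have "[z i j = z' i (r j)] (mod int (d i))" if j: "j \<in> {1..k i}" for j
    using BP.exponents_eq[OF inj w\<sigma> w\<rho> r j]
      mod_residue_iff_cong[OF cycle_family.d_pos[OF P.family[OF i] j]] by blast
  then show "\<exists>r. r permutes {1..k i} \<and> (\<forall>j\<in>{1..k i}. [z i j = z' i (r j)] (mod int (d i)))"
    using r(1) by blast
  obtain f where f: "f ` {1..h i} \<subseteq> {1..h' i}" "inj_on f {1..h i}"
    "\<And>t. t \<in> {1..h i} \<Longrightarrow> r ` P.M i t = Q.M i (f t)"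
    using BP.moved_matching[OF inj w\<sigma> w\<rho> r] by metis
  have "is_cycle m (Q.g i (f t)) \<and> (\<exists>c::int. power_on_moved n (k i) (\<tau> i) (x i t) m c \<and>
      power_on_moved n (k i) (\<tau> i) (y i (f t)) m c)"
    if t: "t \<in> {1..h i}" and m: "is_cycle m (P.g i t)" for t m
  proof -
    have t': "f t \<in> {1..h' i}" using f(1) t by blast
    have m_eq: "m = card (P.M i t)"
      using m block_decomp.g_rotates(3)[OF P.block_decomp[OF i] t] by blast
    have "card (Q.M i (f t)) = card (P.M i t)"
      unfolding f(3)[OF t, symmetric] by (rule card_image[OF permutes_inj_on[OF r(1)]])
    then have "is_cycle m (Q.g i (f t))"
      using block_decomp.g_rotates(3)[OF Q.block_decomp[OF i] t'] m_eq by simp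
    moreover obtain c where c: "\<forall>j\<in>P.M i t. \<forall>q\<in>movpts n (\<tau> i j). (\<rho> ^^ m) q = (\<sigma> ^^ c) q"
      using BP.P.return_exists[OF t] m_eq by blast
    then have "power_on_moved n (k i) (\<tau> i) (x i t) m (int c)"
      using block_decomp.power_on_moved_of_nat[OF P.block_decomp[OF i] t] by blast
    moreover have "power_on_moved n (k i) (\<tau> i) (y i (f t)) m (int c)"
      using BP.return_transfer[OF inj w\<sigma> w\<rho> r t f(3)[OF t] c]
        block_decomp.power_on_moved_of_nat[OF Q.block_decomp[OF i] t'] by blast
    ultimately show ?thesis by blast
  qed
  then show "\<exists>f. f ` {1..h i} \<subseteq> {1..h' i} \<and> inj_on f {1..h i} \<and>
       (\<forall>j\<in>{1..h i}. \<forall>m.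
          is_cycle m (P.g i j) \<longrightarrow> is_cycle m (Q.g i (f j)) \<and>
          (\<exists>c::int. power_on_moved n (k i) (\<tau> i) (x i j) m c \<and>
                    power_on_moved n (k i) (\<tau> i) (y i (f j)) m c))"
    using f(1,2) by (intro exI[of _ f]) blast
qed

end

text \<open>
  A permutation \<open>v\<close> that conjugates \<open>\<mu>0\<close> to \<open>\<mu>0'\<close> in the whole symmetric group need not preserve the fixed
  points of \<open>\<sigma>\<close>. Counting avoids this: on all points the counts agree because of \<open>v\<close>,
  and the points moved by \<open>\<sigma>\<close> contribute the same to both.
\<close>
lemma card_fixed_part_eq:
  assumes v: "v permutes {1..n}" and R: "\<And>q. R q \<longleftrightarrow> R' (v q)"
    and outside: "\<And>q. q \<notin> P.F \<Longrightarrow> R q \<longleftrightarrow> R' q"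
  shows "card {q \<in> P.F. R q} = card {q \<in> P.F. R' q}"
proof -
  have total: "card {q \<in> {1..n}. R q} = card {q \<in> {1..n}. R' q}"
    by (rule card_Collect_permutes[of v "{1..n}" R R', OF v R])
  have split: "card {q \<in> {1..n}. S q} = card {q \<in> P.F. S q} + card {q \<in> {1..n} - P.F. S q}" for S
  proof -
    have "{q \<in> {1..n}. S q} = {q \<in> P.F. S q} \<union> {q \<in> {1..n} - P.F. S q}"
      unfolding fixpts_def by blast
    moreover have "card ({q \<in> P.F. S q} \<union> {q \<in> {1..n} - P.F. S q}) =
        card {q \<in> P.F. S q} + card {q \<in> {1..n} - P.F. S q}"
      by (rule card_Un_disjoint) (auto simp: fixpts_def)
    ultimately show ?thesis by (simp only:)
  qed
  have "{q \<in> {1..n} - P.F. R q} = {q \<in> {1..n} - P.F. R' q}" using outside by blast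
  then show ?thesis using total split[of R] split[of R'] by (simp only: add_right_cancel)
qed

text \<open>
  The counts of points with given coincidences agree on the fixed points of \<open>\<sigma>\<close> because of the second
  assumption and on each block because of the last two, once the injections between the
  moved orbits are known to be onto. That follows from counting fixed points of \<open>\<rho>\<close> and \<open>\<rho>'\<close>.
\<close>
lemma conjugator_exists:
  assumes conj: "\<exists>v. v permutes {1..n} \<and> (\<forall>q. v (\<rho> q) = \<rho>' (v q))"
    and fixed: "\<exists>v. v permutes {1..n} \<and> (\<forall>q. v (\<mu>0 q) = \<mu>0' (v q))"
    and exps: "\<And>i. i \<in> {1..l} \<Longrightarrow>
      \<exists>r. r permutes {1..k i} \<and> (\<forall>j\<in>{1..k i}. [z i j = z' i (r j)] (mod int (d i)))"
    and moved: "\<And>i. i \<in> {1..l} \<Longrightarrow> \<exists>f. f ` {1..h i} \<subseteq> {1..h' i} \<and> inj_on f {1..h i} \<and>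
       (\<forall>j\<in>{1..h i}. \<forall>m.
          is_cycle m (P.g i j) \<longrightarrow> is_cycle m (Q.g i (f j)) \<and>
          (\<exists>c::int. power_on_moved n (k i) (\<tau> i) (x i j) m c \<and>
                    power_on_moved n (k i) (\<tau> i) (y i (f j)) m c))"
  shows "\<exists>w. w permutes {1..n} \<and> (\<forall>q. w (\<sigma> q) = \<sigma> (w q)) \<and> (\<forall>q. w (\<rho> q) = \<rho>' (w q))"
proof -
  obtain v where v: "v permutes {1..n}" "\<And>q. v (\<mu>0 q) = \<mu>0' (v q)" using fixed by blast
  obtain r where r: "\<And>i. i \<in> {1..l} \<Longrightarrow> r i permutes {1..k i} \<and>
      (\<forall>j\<in>{1..k i}. [z i j = z' i (r i j)] (mod int (d i)))"
    using exps by metis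
  obtain f where f: "\<And>i. i \<in> {1..l} \<Longrightarrow> f i ` {1..h i} \<subseteq> {1..h' i}"
      "\<And>i. i \<in> {1..l} \<Longrightarrow> inj_on (f i) {1..h i}"
    and f_moved: "\<And>i j m. \<lbrakk>i \<in> {1..l}; j \<in> {1..h i}; is_cycle m (P.g i j)\<rbrakk> \<Longrightarrow>
          is_cycle m (Q.g i (f i j)) \<and>
          (\<exists>c::int. power_on_moved n (k i) (\<tau> i) (x i j) m c \<and>
                    power_on_moved n (k i) (\<tau> i) (y i (f i j)) m c)"
    using moved by metis
  have residues: "nat (z i j mod int (d i)) mod d i = nat (z' i (r i j) mod int (d i)) mod d i"
    if i: "i \<in> {1..l}" and j: "j \<in> {1..k i}" for i j
    using r[OF i] j mod_residue_iff_cong[OF cycle_family.d_pos[OF P.family[OF i] j]] by blast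
  have cards: "card (Q.M i (f i t)) = card (P.M i t)"
    and return: "\<exists>c. (\<forall>j\<in>P.M i t. \<forall>q\<in>movpts n (\<tau> i j). (\<rho> ^^ card (P.M i t)) q = (\<sigma> ^^ c) q) \<and>
      (\<forall>j\<in>Q.M i (f i t). \<forall>q\<in>movpts n (\<tau> i j). (\<rho>' ^^ card (P.M i t)) q = (\<sigma> ^^ c) q)"
    if i: "i \<in> {1..l}" and t: "t \<in> {1..h i}" for i t
  proof -
    have t': "f i t \<in> {1..h' i}" using f(1)[OF i] t by blast
    have m: "is_cycle (card (P.M i t)) (P.g i t)"
      using block_decomp.g_rotates(3)[OF P.block_decomp[OF i] t] by blast
    show "card (Q.M i (f i t)) = card (P.M i t)"
      using conjunct1[OF f_moved[OF i t m]]
      unfolding block_decomp.g_rotates(3)[OF Q.block_decomp[OF i] t'] by (rule sym)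
    obtain c :: int where "power_on_moved n (k i) (\<tau> i) (x i t) (card (P.M i t)) c"
      "power_on_moved n (k i) (\<tau> i) (y i (f i t)) (card (P.M i t)) c"
      using f_moved[OF i t m] by blast
    then show "\<exists>c. (\<forall>j\<in>P.M i t. \<forall>q\<in>movpts n (\<tau> i j). (\<rho> ^^ card (P.M i t)) q = (\<sigma> ^^ c) q) \<and>
      (\<forall>j\<in>Q.M i (f i t). \<forall>q\<in>movpts n (\<tau> i j). (\<rho>' ^^ card (P.M i t)) q = (\<sigma> ^^ c) q)"
      unfolding block_decomp.power_on_moved_iff[OF P.block_decomp[OF i] t]
        block_decomp.power_on_moved_iff[OF Q.block_decomp[OF i] t'] by blast
  qed
  let ?U = "\<lambda>i. card (\<Union>t\<in>{1..h i}. P.M i t)" and ?U' = "\<lambda>i. card (\<Union>t\<in>{1..h' i}. Q.M i t)"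
  have U_le: "?U i \<le> ?U' i" and f_onto: "?U i = ?U' i \<Longrightarrow> f i ` {1..h i} = {1..h' i}" if i: "i \<in> {1..l}" for i
    using block_pair.card_moved_le[OF block_pair[OF i] f(1)[OF i] f(2)[OF i] cards[OF i]] by blast+
  have zeros: "card {j \<in> {1..k i}. nat (z i j mod int (d i)) mod d i = 0} =
      card {j \<in> {1..k i}. nat (z' i j mod int (d i)) mod d i = 0}" if i: "i \<in> {1..l}" for i
    by (rule card_Collect_permutes[OF conjunct1[OF r[OF i]]]) (simp only: residues[OF i])
  have fix_F: "card {q \<in> P.F. \<rho> q = q} = card {q \<in> P.F. \<rho>' q = q}"
  proof -
    have "card {q \<in> P.F. \<mu>0 q = q} = card {q \<in> P.F. \<mu>0' q = q}"
    proof (rule card_fixed_part_eq[OF v(1)])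
      show "\<mu>0 q = q \<longleftrightarrow> \<mu>0' (v q) = v q" for q
        unfolding v(2)[symmetric] inj_eq[OF permutes_inj[OF v(1)]] ..
      show "\<mu>0 q = q \<longleftrightarrow> \<mu>0' q = q" if "q \<notin> P.F" for q
        using permutes_not_in[OF P.\<mu>0_permutes that] permutes_not_in[OF Q.\<mu>0_permutes that] by simp
    qed
    moreover have "{q \<in> P.F. \<rho> q = q} = {q \<in> P.F. \<mu>0 q = q}" using P.\<rho>_on_F by auto
    moreover have "{q \<in> P.F. \<rho>' q = q} = {q \<in> P.F. \<mu>0' q = q}" using Q.\<rho>_on_F by auto
    ultimately show ?thesis by (simp only:)
  qed
  have fix_all: "card {q \<in> {1..n}. \<rho> q = q} = card {q \<in> {1..n}. \<rho>' q = q}"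
  proof -
    obtain v where v: "v permutes {1..n}" "\<And>q. v (\<rho> q) = \<rho>' (v q)" using conj by blast
    have "\<rho> q = q \<longleftrightarrow> \<rho>' (v q) = v q" for q
      unfolding v(2)[symmetric] inj_eq[OF permutes_inj[OF v(1)]] ..
    then show ?thesis by (intro card_Collect_permutes[OF v(1)])
  qed
  (* Fixed points and moved cycles, weighted by their length, have the same sum for both
     permutations in each block. As there are equally many fixed points in total, the weighted
     sums of moved cycles agree, and the inequality in each block is an equality. *)
  have U_eq: "?U i = ?U' i" if i: "i \<in> {1..l}" for i
  proof -
    have "card {q \<in> P.B i. \<rho> q = q} + d i * ?U i = card {q \<in> P.B i. \<rho>' q = q} + d i * ?U' i"
      if "i \<in> {1..l}" for i
      using block_action.card_fixed_points[OF P.block_action[OF that]]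
        block_action.card_fixed_points[OF Q.block_action[OF that]] zeros[OF that] by (simp only:)
    then have "(\<Sum>i\<in>{1..l}. card {q \<in> P.B i. \<rho> q = q} + d i * ?U i) =
        (\<Sum>i\<in>{1..l}. card {q \<in> P.B i. \<rho>' q = q} + d i * ?U' i)"
      by (rule sum.cong[OF refl])
    moreover have "(\<Sum>i\<in>{1..l}. card {q \<in> P.B i. \<rho> q = q}) = (\<Sum>i\<in>{1..l}. card {q \<in> P.B i. \<rho>' q = q})"
      using fix_all fix_F P.card_points_eq[of "\<lambda>q. \<rho> q = q"] P.card_points_eq[of "\<lambda>q. \<rho>' q = q"] by linarith
    ultimately have total: "(\<Sum>i\<in>{1..l}. d i * ?U i) = (\<Sum>i\<in>{1..l}. d i * ?U' i)"
      unfolding sum.distrib by linarith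
    have "d i * ?U i = d i * ?U' i"
      by (rule sum_mono_inv[OF total _ i]) (use U_le in \<open>auto intro: mult_le_mono2\<close>)
    moreover have "d i > 0"
    proof -
      have "k i \<ge> 1" using P.grouping i unfolding cycle_grouping_def by blast
      then show ?thesis using cycle_family.d_pos[OF P.family[OF i], of 1] by simp
    qed
    ultimately show ?thesis by simp
  qed
  have B_counts: "card {q \<in> P.B i. coincidences \<sigma> \<rho> q = T} = card {q \<in> P.B i. coincidences \<sigma> \<rho>' q = T}"
    if i: "i \<in> {1..l}" for i T
  proof (rule block_pair.card_coincidences_eq[OF block_pair[OF i]])
    show "r i permutes {1..k i}" using r[OF i] by blast
    show "bij_betw (f i) {1..h i} {1..h' i}"
      using f_onto[OF i U_eq[OF i]] f(2)[OF i] unfolding bij_betw_def by blast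
  qed (use residues cards return i in blast)+
  (* Where sigma is the identity, the coincidences are those of id and mu0. *)
  have F_counts: "card {q \<in> P.F. coincidences \<sigma> \<rho> q = T} = card {q \<in> P.F. coincidences \<sigma> \<rho>' q = T}" for T
  proof -
    have id: "coincidences \<sigma> \<rho> q = coincidences id \<mu>0 q" if "q \<in> P.F" for q
    proof -
      have "(\<rho> ^^ u) q = (\<mu>0 ^^ u) q \<and> (\<mu>0 ^^ u) q \<in> P.F" for u
        using that P.\<rho>_on_F permutes_in_image[OF P.\<mu>0_permutes] by (induction u) simp_all
      moreover have "(\<sigma> ^^ u) p = p" if "p \<in> P.F" for u p
        using that by (induction u) (auto simp: fixpts_def)
      ultimately show ?thesis unfolding coincidences_def by simp
    qed
    have id': "coincidences \<sigma> \<rho>' q = coincidences id \<mu>0' q" if "q \<in> P.F" for q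
    proof -
      have "(\<rho>' ^^ u) q = (\<mu>0' ^^ u) q \<and> (\<mu>0' ^^ u) q \<in> P.F" for u
        using that Q.\<rho>_on_F permutes_in_image[OF Q.\<mu>0_permutes] by (induction u) simp_all
      moreover have "(\<sigma> ^^ u) p = p" if "p \<in> P.F" for u p
        using that by (induction u) (auto simp: fixpts_def)
      ultimately show ?thesis unfolding coincidences_def by simp
    qed
    have "card {q \<in> P.F. coincidences id \<mu>0 q = T} = card {q \<in> P.F. coincidences id \<mu>0' q = T}"
    proof (rule card_fixed_part_eq[OF v(1)])
      have vpow: "v ((\<mu>0 ^^ u) q) = (\<mu>0' ^^ u) (v q)" for u q by (induction u) (simp_all add: v(2))
      show "coincidences id \<mu>0 q = T \<longleftrightarrow> coincidences id \<mu>0' (v q) = T" for q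
        unfolding coincidences_def by (simp add: inj_eq[OF permutes_inj[OF v(1)]] flip: vpow)
      have "(\<mu>0 ^^ u) q = q" "(\<mu>0' ^^ u) q = q" if "q \<notin> P.F" for u q
        using permutes_not_in[OF P.\<mu>0_permutes that] permutes_not_in[OF Q.\<mu>0_permutes that]
        by (induction u) simp_all
      then show "coincidences id \<mu>0 q = T \<longleftrightarrow> coincidences id \<mu>0' q = T" if "q \<notin> P.F" for q
        using that unfolding coincidences_def by simp
    qed
    moreover have "{q \<in> P.F. coincidences \<sigma> \<rho> q = T} = {q \<in> P.F. coincidences id \<mu>0 q = T}" using id by auto
    moreover have "{q \<in> P.F. coincidences \<sigma> \<rho>' q = T} = {q \<in> P.F. coincidences id \<mu>0' q = T}" using id' by auto
    ultimately show ?thesis by (simp only:)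
  qed
  have "\<exists>w. bij_betw w {1..n} {1..n} \<and> (\<forall>q\<in>{1..n}. w (\<sigma> q) = \<sigma> (w q) \<and> w (\<rho> q) = \<rho>' (w q))"
  proof (rule equivariant_bij_exists)
    show "inj \<sigma>" "inj \<rho>" "inj \<sigma>" "inj \<rho>'"
      using permutes_inj P.\<sigma>_permutes P.\<rho>_permutes Q.\<rho>_permutes by blast+
    show "\<sigma> \<circ> \<rho> = \<rho> \<circ> \<sigma>" "\<sigma> \<circ> \<rho>' = \<rho>' \<circ> \<sigma>" by (rule P.comm Q.comm)+
    show "\<sigma> ` {1..n} \<subseteq> {1..n}" "\<rho> ` {1..n} \<subseteq> {1..n}" "\<sigma> ` {1..n} \<subseteq> {1..n}" "\<rho>' ` {1..n} \<subseteq> {1..n}"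
      using permutes_image[OF P.\<sigma>_permutes] permutes_image[OF P.\<rho>_permutes]
        permutes_image[OF Q.\<rho>_permutes] by (simp_all only: order_refl)
    show "card {q \<in> {1..n}. coincidences \<sigma> \<rho> q = T} = card {q \<in> {1..n}. coincidences \<sigma> \<rho>' q = T}" for T
      unfolding P.card_points_eq using B_counts F_counts by (simp only: cong: sum.cong)
  qed simp_all
  then obtain w0 where w0: "bij_betw w0 {1..n} {1..n}"
    "\<forall>q\<in>{1..n}. w0 (\<sigma> q) = \<sigma> (w0 q) \<and> w0 (\<rho> q) = \<rho>' (w0 q)" by blast
  define w where "w q = (if q \<in> {1..n} then w0 q else q)" for q
  have "bij_betw w {1..n} {1..n}" using w0(1) bij_betw_cong[of "{1..n}" w w0] by (simp add: w_def)
  then have "w permutes {1..n}" by (rule bij_imp_permutes) (simp only: w_def if_False)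
  moreover have "w (p q) = p' (w q)" if p: "p permutes {1..n}" "p' permutes {1..n}"
    and eq: "\<And>q. q \<in> {1..n} \<Longrightarrow> w0 (p q) = p' (w0 q)" for p p' q
  proof (cases "q \<in> {1..n}")
    case True
    then have "p q \<in> {1..n}" using permutes_in_image[OF p(1)] by blast
    then show ?thesis using eq[OF True] True by (simp only: w_def if_True)
  next
    case False
    then show ?thesis
      using permutes_not_in[OF p(1) False] permutes_not_in[OF p(2) False] by (simp only: w_def if_False)
  qed
  ultimately show ?thesis
    using w0(2) P.\<sigma>_permutes P.\<rho>_permutes Q.\<rho>_permutes by blast
qed

end

section \<open>The conjugacy criterion\<close>

theorem theorem3p1:
  fixes A :: "('a, 'm) monoid_scheme"
    and a b :: 'a
    and n l :: nat
    and \<phi> \<psi> :: "'a \<Rightarrow> nat \<Rightarrow> nat"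
    and \<sigma> \<mu>0 \<mu>0' :: "nat \<Rightarrow> nat"
    and k d h h' :: "nat \<Rightarrow> nat"
    and \<tau> x y :: "nat \<Rightarrow> nat \<Rightarrow> nat \<Rightarrow> nat"
    and \<pi> \<pi>' \<mu> \<mu>' \<pi>0 \<pi>0' :: "nat \<Rightarrow> nat \<Rightarrow> nat"
    and z z' :: "nat \<Rightarrow> nat \<Rightarrow> int"
  assumes "comm_group A"
    and "a \<in> carrier A" and "b \<in> carrier A"
    and "generate A {a, b} = carrier A"
    and "\<phi> \<in> hom A (sym_group n)" and "\<psi> \<in> hom A (sym_group n)"
    and "generator_conjugate (sym_group n) [a, b] \<phi> \<psi>"
    and "\<phi> a = \<sigma>" and "\<psi> a = \<sigma>"
    and "cycle_grouping n \<sigma> l k d \<tau>"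
    and "cent_decomp n \<sigma> l k \<tau> (\<phi> b) \<mu>0 \<pi> \<mu> \<pi>0 z h x"
    and "cent_decomp n \<sigma> l k \<tau> (\<psi> b) \<mu>0' \<pi>' \<mu>' \<pi>0' z' h' y"
  shows "conjugate_homs A (sym_group n) \<phi> \<psi> \<longleftrightarrow>
    conjugate_in (sym_group n) \<mu>0 \<mu>0' \<and>
    (\<forall>i\<in>{1..l}. \<exists>r. r permutes {1..k i} \<and>
       (\<forall>j\<in>{1..k i}. [z i j = z' i (r j)] (mod int (d i)))) \<and>
    (\<forall>i\<in>{1..l}. \<exists>f. f ` {1..h i} \<subseteq> {1..h' i} \<and> inj_on f {1..h i} \<and>
       (\<forall>j\<in>{1..h i}. \<forall>m.
          is_cycle m (cent_image n (k i) (\<tau> i) (x i j)) \<longrightarrow>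
          is_cycle m (cent_image n (k i) (\<tau> i) (y i (f j))) \<and>
          (\<exists>c::int. power_on_moved n (k i) (\<tau> i) (x i j) m c \<and>
                    power_on_moved n (k i) (\<tau> i) (y i (f j)) m c)))"
proof -
  interpret A: comm_group A by fact
  interpret \<phi>: group_hom A "sym_group n" \<phi>
    using assms(5) sym_group_is_group by (simp add: group_hom_def group_hom_axioms_def A.group_axioms)
  interpret \<psi>: group_hom A "sym_group n" \<psi>
    using assms(6) sym_group_is_group by (simp add: group_hom_def group_hom_axioms_def A.group_axioms)
  have perm: "\<phi> b permutes {1..n}" "\<psi> b permutes {1..n}"
    using \<phi>.hom_closed[OF assms(3)] \<psi>.hom_closed[OF assms(3)] unfolding sym_group_carrier .
  have ab: "a \<otimes>\<^bsub>A\<^esub> b = b \<otimes>\<^bsub>A\<^esub> a" by (rule A.m_comm[OF assms(2,3)])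
  have comm: "\<sigma> \<circ> \<phi> b = \<phi> b \<circ> \<sigma>" "\<sigma> \<circ> \<psi> b = \<psi> b \<circ> \<sigma>"
    using arg_cong[OF ab, of \<phi>] arg_cong[OF ab, of \<psi>]
    unfolding \<phi>.hom_mult[OF assms(2,3)] \<phi>.hom_mult[OF assms(3,2)]
      \<psi>.hom_mult[OF assms(2,3)] \<psi>.hom_mult[OF assms(3,2)] sym_group_mult assms(8,9) .
  interpret D: decomposed_pair n l \<sigma> k d \<tau> "\<phi> b" \<mu>0 \<pi> \<mu> \<pi>0 z h x "\<psi> b" \<mu>0' \<pi>' \<mu>' \<pi>0' z' h' y
    by (intro decomposed_pair.intro decomposed_perm.intro decomposed_perm_axioms.intro grouped_perm.intro)
      (fact assms perm comm)+
  have b: "\<exists>v. v permutes {1..n} \<and> (\<forall>q. v (\<phi> b q) = \<psi> b (v q))"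
    using assms(7) unfolding generator_conjugate_def conjugate_in_sym_group by simp
  have conj: "conjugate_homs A (sym_group n) \<phi> \<psi> \<longleftrightarrow>
      (\<exists>w. w permutes {1..n} \<and> (\<forall>q. w (\<sigma> q) = \<sigma> (w q)) \<and> (\<forall>q. w (\<phi> b q) = \<psi> b (w q)))"
    using conjugate_homs_sym_group[OF A.group_axioms assms(5,6) _ assms(4)] assms(2,3,8,9) by simp
  show ?thesis unfolding conj conjugate_in_sym_group
  proof (intro iffI)
    assume "\<exists>w. w permutes {1..n} \<and> (\<forall>q. w (\<sigma> q) = \<sigma> (w q)) \<and> (\<forall>q. w (\<phi> b q) = \<psi> b (w q))"
    then obtain w where w: "w permutes {1..n}" "\<And>q. w (\<sigma> q) = \<sigma> (w q)" "\<And>q. w (\<phi> b q) = \<psi> b (w q)"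
      by blast
    show "(\<exists>v. v permutes {1..n} \<and> (\<forall>q. v (\<mu>0 q) = \<mu>0' (v q))) \<and>
      (\<forall>i\<in>{1..l}. \<exists>r. r permutes {1..k i} \<and>
         (\<forall>j\<in>{1..k i}. [z i j = z' i (r j)] (mod int (d i)))) \<and>
      (\<forall>i\<in>{1..l}. \<exists>f. f ` {1..h i} \<subseteq> {1..h' i} \<and> inj_on f {1..h i} \<and>
         (\<forall>j\<in>{1..h i}. \<forall>m.
            is_cycle m (cent_image n (k i) (\<tau> i) (x i j)) \<longrightarrow>
            is_cycle m (cent_image n (k i) (\<tau> i) (y i (f j))) \<and>
            (\<exists>c::int. power_on_moved n (k i) (\<tau> i) (x i j) m c \<and>
                      power_on_moved n (k i) (\<tau> i) (y i (f j)) m c)))"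
      by (intro conjI ballI D.conjugate_fixed_parts[OF w] D.block_invariants(1)[OF w]
          D.block_invariants(2)[OF w])
  next
    assume "(\<exists>v. v permutes {1..n} \<and> (\<forall>q. v (\<mu>0 q) = \<mu>0' (v q))) \<and>
      (\<forall>i\<in>{1..l}. \<exists>r. r permutes {1..k i} \<and>
         (\<forall>j\<in>{1..k i}. [z i j = z' i (r j)] (mod int (d i)))) \<and>
      (\<forall>i\<in>{1..l}. \<exists>f. f ` {1..h i} \<subseteq> {1..h' i} \<and> inj_on f {1..h i} \<and>
         (\<forall>j\<in>{1..h i}. \<forall>m.
            is_cycle m (cent_image n (k i) (\<tau> i) (x i j)) \<longrightarrow>
            is_cycle m (cent_image n (k i) (\<tau> i) (y i (f j))) \<and>
            (\<exists>c::int. power_on_moved n (k i) (\<tau> i) (x i j) m c \<and>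
                      power_on_moved n (k i) (\<tau> i) (y i (f j)) m c)))"
    then show "\<exists>w. w permutes {1..n} \<and> (\<forall>q. w (\<sigma> q) = \<sigma> (w q)) \<and> (\<forall>q. w (\<phi> b q) = \<psi> b (w q))"
      by (elim conjE) (rule D.conjugator_exists[OF b], assumption, (erule (1) bspec)+)
  qed
qed

end
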